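(* Let $\mathcal{C}$ be a finite connected category and write $\operatorname{soc}(1_{\mathcal{C}})=S_1\sqcup\cdots\sqcup S_n$ as the disjoint union of its simple $\mathcal{C}$-subsets $S_1,\dots,S_n$. For each $i$ let $\mathcal{C}_i$ be the full subcategory of $\mathcal{C}$ whose set of objects is $\operatorname{supp}(S_i)$. Then there is a ring isomorphism $$B^S(\mathcal{C})\cong\prod_{i=1}^n B^S(\mathcal{C}_i).$$
   Context: For a finite category $\mathcal{C}$ with object set $\mathcal{C}_0$, a $\mathcal{C}$-set is a covariant functor $\Omega$ from $\mathcal{C}$ to the category of finite sets; morphisms of $\mathcal{C}$-sets are natural transformations; a $\mathcal{C}$-subset is a subfunctor. Disjoint unions and products of $\mathcal{C}$-sets are formed objectwise. The empty $\mathcal{C}$-set sends every object to $\emptyset$. A $\mathcal{C}$-set is simple if it is non-empty and its only $\mathcal{C}$-subsets are itself and the empty $\mathcal{C}$-set. The support is $\operatorname{supp}(\Omega)=\{x\in\mathcal{C}_0\mid \Omega(x)\neq\emptyset\}$. The socle $\operatorname{soc}(\Omega)$ is the union of all simple $\mathcal{C}$-subsets of $\Omega$ (distinct simple $\mathcal{C}$-subsets are disjoint, so this is a disjoint union). $1_{\mathcal{C}}$ is the $\mathcal{C}$-set sending every object to a one-point set. The simple Burnside ring $B^S(\mathcal{C})$ is the Grothendieck group, with respect to disjoint union, of isomorphism classes of finite disjoint unions of simple $\mathcal{C}$-sets (equivalently, the free abelian group on isomorphism classes of simple $\mathcal{C}$-sets), with the bilinear product determined by $[S]\star[T]=[\operatorname{soc}(S\times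 T)]$ and identity element $[\operatorname{soc}(1_{\mathcal{C}})]$. *)

theory Defs
  imports "HOL-Algebra.Chinese_Remainder"
begin

section \<open>Finite categories\<close>

text \<open>\<open>Comp C g f\<close> is the composite "g after f".\<close>

record ('o, 'm) category =
  Obj :: "'o set"
  Arr :: "'m set"
  Dom :: "'m \<Rightarrow> 'o"
  Cod :: "'m \<Rightarrow> 'o"
  Id :: "'o \<Rightarrow> 'm"
  Comp :: "'m \<Rightarrow> 'm \<Rightarrow> 'm"

locale category =
  fixes C :: "('o, 'm) category" (structure)
  assumes Dom_in: "f \<in> Arr C \<Longrightarrow> Dom C f \<in> Obj C"
    and Cod_in: "f \<in> Arr C \<Longrightarrow> Cod C f \<in> Obj C"
    and Id_in: "x \<in> Obj C \<Longrightarrow> Id C x \<in> Arr C"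
    and Dom_Id: "x \<in> Obj C \<Longrightarrow> Dom C (Id C x) = x"
    and Cod_Id: "x \<in> Obj C \<Longrightarrow> Cod C (Id C x) = x"
    and Comp_in: "\<lbrakk>f \<in> Arr C; g \<in> Arr C; Cod C f = Dom C g\<rbrakk> \<Longrightarrow> Comp C g f \<in> Arr C"
    and Dom_Comp: "\<lbrakk>f \<in> Arr C; g \<in> Arr C; Cod C f = Dom C g\<rbrakk> \<Longrightarrow> Dom C (Comp C g f) = Dom C f"
    and Cod_Comp: "\<lbrakk>f \<in> Arr C; g \<in> Arr C; Cod C f = Dom C g\<rbrakk> \<Longrightarrow> Cod C (Comp C g f) = Cod C g"
    and Comp_Id: "f \<in> Arr C \<Longrightarrow> Comp C f (Id C (Dom C f)) = f"
    and Id_Comp: "f \<in> Arr C \<Longrightarrow> Comp C (Id C (Cod C f)) f = f"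
    and Comp_assoc: "\<lbrakk>f \<in> Arr C; g \<in> Arr C; h \<in> Arr C; Cod C f = Dom C g; Cod C g = Dom C h\<rbrakk>
      \<Longrightarrow> Comp C h (Comp C g f) = Comp C (Comp C h g) f"

locale finite_category = category +
  assumes finite_Obj: "finite (Obj C)"
    and finite_Arr: "finite (Arr C)"

text \<open>Any two objects are joined by a finite zigzag of morphisms. The empty category is not
  excluded.\<close>

definition connected_category :: "('o, 'm) category \<Rightarrow> bool" where
  "connected_category C \<longleftrightarrow>
     (\<forall>x \<in> Obj C. \<forall>y \<in> Obj C.
        (x, y) \<in> ((\<lambda>f. (Dom C f, Cod C f)) ` Arr C \<union> (\<lambda>f. (Cod C f, Dom C f)) ` Arr C)\<^sup>*)"

definition full_subcategory :: "('o, 'm) category \<Rightarrow> 'o set \<Rightarrow> ('o, 'm) category" where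
  "full_subcategory C A =
     C\<lparr>Obj := Obj C \<inter> A, Arr := {f \<in> Arr C. Dom C f \<in> A \<and> Cod C f \<in> A}\<rparr>"


section \<open>\<open>C\<close>-sets\<close>

text \<open>A functor to finite sets, all of whose values are subsets of one type \<open>'a\<close>.\<close>

record ('o, 'm, 'a) cset =
  pts :: "'o \<Rightarrow> 'a set"
  act :: "'m \<Rightarrow> 'a \<Rightarrow> 'a"

text \<open>The values off the domains of definition are pinned down, by the two conditions on
  \<open>x \<notin> Obj C\<close> and \<open>f \<notin> Arr C\<close> and by the extensional function space, so that
  equality of records is equality of functors.\<close>

definition is_cset :: "('o, 'm) category \<Rightarrow> ('o, 'm, 'a) cset \<Rightarrow> bool" where
  "is_cset C X \<longleftrightarrow>
     (\<forall>x \<in> Obj C. finite (pts X x)) \<and>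
     (\<forall>f \<in> Arr C. act X f \<in> pts X (Dom C f) \<rightarrow>\<^sub>E pts X (Cod C f)) \<and>
     (\<forall>x \<in> Obj C. \<forall>a \<in> pts X x. act X (Id C x) a = a) \<and>
     (\<forall>f \<in> Arr C. \<forall>g \<in> Arr C. Cod C f = Dom C g \<longrightarrow>
        (\<forall>a \<in> pts X (Dom C f). act X (Comp C g f) a = act X g (act X f a))) \<and>
     (\<forall>x. x \<notin> Obj C \<longrightarrow> pts X x = {}) \<and>
     (\<forall>f. f \<notin> Arr C \<longrightarrow> act X f = (\<lambda>a. undefined))"

text \<open>Restricts arbitrary data to the domains of definition in the sense of \<open>is_cset\<close>.\<close>

definition mk_cset ::
  "('o, 'm) category \<Rightarrow> ('o \<Rightarrow> 'a set) \<Rightarrow> ('m \<Rightarrow> 'a \<Rightarrow> 'a) \<Rightarrow> ('o, 'm, 'a) cset" where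
  "mk_cset C A \<phi> =
     \<lparr>pts = (\<lambda>x. if x \<in> Obj C then A x else {}),
      act = (\<lambda>f. if f \<in> Arr C then restrict (\<phi> f) (A (Dom C f)) else (\<lambda>a. undefined))\<rparr>"

definition empty_cset :: "('o, 'm) category \<Rightarrow> ('o, 'm, 'a) cset" where
  "empty_cset C = mk_cset C (\<lambda>x. {}) (\<lambda>f a. a)"

definition one_cset :: "('o, 'm) category \<Rightarrow> ('o, 'm, unit) cset" where
  "one_cset C = mk_cset C (\<lambda>x. {()}) (\<lambda>f a. a)"

definition prod_cset ::
  "('o, 'm) category \<Rightarrow> ('o, 'm, 'a) cset \<Rightarrow> ('o, 'm, 'b) cset \<Rightarrow> ('o, 'm, 'a \<times> 'b) cset" where
  "prod_cset C X Y =
     mk_cset C (\<lambda>x. pts X x \<times> pts Y x) (\<lambda>f. map_prod (act X f) (act Y f))"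

definition sum_cset ::
  "('o, 'm) category \<Rightarrow> ('o, 'm, 'a) cset \<Rightarrow> ('o, 'm, 'b) cset \<Rightarrow> ('o, 'm, 'a + 'b) cset" where
  "sum_cset C X Y =
     mk_cset C (\<lambda>x. pts X x <+> pts Y x) (\<lambda>f. map_sum (act X f) (act Y f))"

definition disjoint_union_cset ::
  "('o, 'm) category \<Rightarrow> 'i set \<Rightarrow> ('i \<Rightarrow> ('o, 'm, 'a) cset) \<Rightarrow> ('o, 'm, 'i \<times> 'a) cset" where
  "disjoint_union_cset C I X =
     mk_cset C (\<lambda>x. SIGMA i:I. pts (X i) x) (\<lambda>f (i, a). (i, act (X i) f a))"

definition csubset ::
  "('o, 'm) category \<Rightarrow> ('o, 'm, 'a) cset \<Rightarrow> ('o, 'm, 'a) cset \<Rightarrow> bool" where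
  "csubset C Y X \<longleftrightarrow> is_cset C Y \<and>
     (\<forall>x \<in> Obj C. pts Y x \<subseteq> pts X x) \<and>
     (\<forall>f \<in> Arr C. \<forall>a \<in> pts Y (Dom C f). act Y f a = act X f a)"

definition simple_cset :: "('o, 'm) category \<Rightarrow> ('o, 'm, 'a) cset \<Rightarrow> bool" where
  "simple_cset C X \<longleftrightarrow> is_cset C X \<and> X \<noteq> empty_cset C \<and>
     (\<forall>Y. csubset C Y X \<longrightarrow> Y = X \<or> Y = empty_cset C)"

definition simple_csubsets ::
  "('o, 'm) category \<Rightarrow> ('o, 'm, 'a) cset \<Rightarrow> ('o, 'm, 'a) cset set" where
  "simple_csubsets C X = {S. csubset C S X \<and> simple_cset C S}"

definition soc :: "('o, 'm) category \<Rightarrow> ('o, 'm, 'a) cset \<Rightarrow> ('o, 'm, 'a) cset" where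
  "soc C X = mk_cset C (\<lambda>x. \<Union>S \<in> simple_csubsets C X. pts S x) (act X)"

definition supp :: "('o, 'm) category \<Rightarrow> ('o, 'm, 'a) cset \<Rightarrow> 'o set" where
  "supp C X = {x \<in> Obj C. pts X x \<noteq> {}}"

definition nat_trans ::
  "('o, 'm) category \<Rightarrow> ('o, 'm, 'a) cset \<Rightarrow> ('o, 'm, 'b) cset \<Rightarrow> ('o \<Rightarrow> 'a \<Rightarrow> 'b) \<Rightarrow> bool" where
  "nat_trans C X Y \<eta> \<longleftrightarrow>
     (\<forall>x \<in> Obj C. \<eta> x \<in> pts X x \<rightarrow> pts Y x) \<and>
     (\<forall>f \<in> Arr C. \<forall>a \<in> pts X (Dom C f). \<eta> (Cod C f) (act X f a) = act Y f (\<eta> (Dom C f) a))"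

definition iso_cset ::
  "('o, 'm) category \<Rightarrow> ('o, 'm, 'a) cset \<Rightarrow> ('o, 'm, 'b) cset \<Rightarrow> bool" where
  "iso_cset C X Y \<longleftrightarrow>
     (\<exists>\<eta> \<theta>. nat_trans C X Y \<eta> \<and> nat_trans C Y X \<theta> \<and>
        (\<forall>x \<in> Obj C. (\<forall>a \<in> pts X x. \<theta> x (\<eta> x a) = a) \<and> (\<forall>b \<in> pts Y x. \<eta> x (\<theta> x b) = b)))"


section \<open>Isomorphism classes\<close>

text \<open>Every \<open>C\<close>-set of a finite category is isomorphic to one with values in finite subsets of
  \<^typ>\<open>nat\<close>. So the isomorphism class of a \<open>C\<close>-set over an arbitrary type is recorded by
  its members over \<^typ>\<open>nat\<close>; two \<open>C\<close>-sets have the same class iff they are isomorphic.\<close>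

type_synonym ('o, 'm) cset_class = "('o, 'm, nat) cset set"

definition iso_class :: "('o, 'm) category \<Rightarrow> ('o, 'm, 'a) cset \<Rightarrow> ('o, 'm) cset_class" where
  "iso_class C X = {Y. is_cset C Y \<and> iso_cset C X Y}"

text \<open>Classes of finite disjoint unions of simple \<open>C\<close>-sets; \<open>n = 0\<close> gives the
  empty \<open>C\<close>-set.\<close>

definition semisimple_classes :: "('o, 'm) category \<Rightarrow> ('o, 'm) cset_class set" where
  "semisimple_classes C =
     {iso_class C (disjoint_union_cset C {..<n} S) | (n :: nat) (S :: nat \<Rightarrow> ('o, 'm, nat) cset).
        \<forall>i < n. simple_cset C (S i)}"

text \<open>The semiring of these classes. The unions over representatives are unions of equal
  classes. The product is \<open>[X] \<star> [Y] = [soc (X \<times> Y)]\<close>; since products distribute over disjoint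
  unions and \<open>soc\<close> commutes with disjoint unions, it is biadditive, hence determined by its
  values on simple \<open>C\<close>-sets.\<close>

definition semisimple_semiring :: "('o, 'm) category \<Rightarrow> ('o, 'm) cset_class ring" where
  "semisimple_semiring C =
     \<lparr>carrier = semisimple_classes C,
      monoid.mult = (\<lambda>A B. \<Union>X \<in> A. \<Union>Y \<in> B. iso_class C (soc C (prod_cset C X Y))),
      one = iso_class C (soc C (one_cset C)),
      zero = iso_class C (empty_cset C :: ('o, 'm, nat) cset),
      add = (\<lambda>A B. \<Union>X \<in> A. \<Union>Y \<in> B. iso_class C (sum_cset C X Y))\<rparr>"


section \<open>Grothendieck rings and the simple Burnside ring\<close>

text \<open>The pair \<open>(a, b)\<close> stands for the formal difference \<open>a - b\<close>. The extra summand
  \<open>c\<close> makes this an equivalence relation without assuming cancellation.\<close>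

definition groth_rel :: "('a, 'n) ring_scheme \<Rightarrow> (('a \<times> 'a) \<times> ('a \<times> 'a)) set" where
  "groth_rel R =
     {((a, b), (a', b')) | a b a' b'.
        a \<in> carrier R \<and> b \<in> carrier R \<and> a' \<in> carrier R \<and> b' \<in> carrier R \<and>
        (\<exists>c \<in> carrier R. (a \<oplus>\<^bsub>R\<^esub> b') \<oplus>\<^bsub>R\<^esub> c = (a' \<oplus>\<^bsub>R\<^esub> b) \<oplus>\<^bsub>R\<^esub> c)}"

definition grothendieck_ring :: "('a, 'n) ring_scheme \<Rightarrow> ('a \<times> 'a) set ring" where
  "grothendieck_ring R =
     \<lparr>carrier = (carrier R \<times> carrier R) // groth_rel R,
      monoid.mult = (\<lambda>P Q. \<Union>(a, b) \<in> P. \<Union>(c, d) \<in> Q.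
        groth_rel R `` {((a \<otimes>\<^bsub>R\<^esub> c) \<oplus>\<^bsub>R\<^esub> (b \<otimes>\<^bsub>R\<^esub> d), (a \<otimes>\<^bsub>R\<^esub> d) \<oplus>\<^bsub>R\<^esub> (b \<otimes>\<^bsub>R\<^esub> c))}),
      one = groth_rel R `` {(\<one>\<^bsub>R\<^esub>, \<zero>\<^bsub>R\<^esub>)},
      zero = groth_rel R `` {(\<zero>\<^bsub>R\<^esub>, \<zero>\<^bsub>R\<^esub>)},
      add = (\<lambda>P Q. \<Union>(a, b) \<in> P. \<Union>(c, d) \<in> Q.
        groth_rel R `` {(a \<oplus>\<^bsub>R\<^esub> c, b \<oplus>\<^bsub>R\<^esub> d)})\<rparr>"

definition simple_burnside_ring ::
  "('o, 'm) category \<Rightarrow> (('o, 'm) cset_class \<times> ('o, 'm) cset_class) set ring" where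
  "simple_burnside_ring C = grothendieck_ring (semisimple_semiring C)"

end

theory Submission
  imports Defs
begin

text \<open>Call a point \<open>a\<close> of a \<open>C\<close>-set recurrent if whatever \<open>f\<close> moves it, some \<open>g\<close> moves it back:
  \<open>g f a = a\<close>. The socle consists of the recurrent points, so a \<open>C\<close>-set is a disjoint union of simple
  ones iff all its points are recurrent. The objects at which the point of \<open>1\<close> is recurrent are the
  disjoint union of the supports of the \<open>S\<^sub>i\<close>, each closed under outgoing morphisms, and every
  semisimple \<open>C\<close>-set lives over them. Recurrence at an object of \<open>C\<^sub>i\<close> only involves
  \<open>C\<^sub>i\<close>, so restriction commutes with socles, products and sums. Since \<open>C\<close>-sets over the different
  \<open>C\<^sub>i\<close> glue uniquely, the semiring of semisimple classes is already a product, and so is its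
  Grothendieck ring.\<close>

section \<open>Grothendieck rings of products\<close>

text \<open>Simplicity amounts to transitivity, since the subset generated by a point of a simple
  \<open>C\<close>-set is everything; recurrence is what remains of transitivity when a single point
  is looked at. Unlike a decomposition into simples, it is preserved by every natural
  transformation. Applied to the map to \<open>one_cset C\<close>, this confines the points of a
  semisimple \<open>C\<close>-set to the recurrent objects.

  Two obstacles come from the encoding. An isomorphism class keeps only members over
  \<open>nat\<close>, while sums, products and disjoint unions have their points in other types; a
  copy over \<open>nat\<close> is therefore made whenever a class has to be known nonempty or
  semisimple. And formal differences are related by way of an unknown summand \<open>c\<close>, so
  relations that hold in every factor give a relation in the product only after the separate
  summands are lifted to a single one. For this the semiring isomorphism is used in the form of
  homomorphisms \<open>\<phi> i\<close> that are jointly injective and jointly surjective.\<close>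

lemma map_in_ring_hom_RDirProd_list:
  assumes "\<And>i. i \<in> set is \<Longrightarrow> h i \<in> ring_hom R (Q i)"
  shows "(\<lambda>a. map (\<lambda>i. h i a) is) \<in> ring_hom R (RDirProd_list (map Q is))"
  using assms
proof (induction "is")
  case Nil
  then show ?case
    by (auto simp: ring_hom_def monoid.defs)
next
  case (Cons j js)
  \<comment> \<open>The tuple map is a composite: the diagonal, then \<open>h j\<close> on one
    factor and the tuple of the remaining maps on the other, then consing.\<close>
  have "(\<lambda>(r, s). (h j r, map (\<lambda>i. h i s) js))
      \<in> ring_hom (RDirProd R R) (RDirProd (Q j) (RDirProd_list (map Q js)))"
    using Cons by (intro RDirProd_hom3) auto
  from ring_hom_trans[OF ring_hom_trans[OF RDirProd_hom1 this] RDirProd_list_hom1]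
  show ?case
    by (simp add: comp_def case_prod_beta)
qed

lemma groth_rel_Image:
  "groth_rel R `` {(a, b)} =
     {(a', b'). a \<in> carrier R \<and> b \<in> carrier R \<and> a' \<in> carrier R \<and> b' \<in> carrier R \<and>
        (\<exists>c \<in> carrier R. (a \<oplus>\<^bsub>R\<^esub> b') \<oplus>\<^bsub>R\<^esub> c = (a' \<oplus>\<^bsub>R\<^esub> b) \<oplus>\<^bsub>R\<^esub> c)}"
  by (auto simp: groth_rel_def)

text \<open>Both operations of the Grothendieck ring are unions of this shape, with \<open>f\<close>
  and \<open>g\<close> forming the pair that represents a sum or product of two differences. Images
  commute with unions, so compatibility need only be checked on single pairs of
  representatives.\<close>

lemma map_prod_image_groth_mult:
  assumes "\<And>a b c d. \<lbrakk>(a, b) \<in> P; (c, d) \<in> Q\<rbrakk> \<Longrightarrow>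
      map_prod \<phi> \<phi> ` groth_rel R `` {f a b c d} = groth_rel S `` {g (\<phi> a) (\<phi> b) (\<phi> c) (\<phi> d)}"
  shows "map_prod \<phi> \<phi> ` (\<Union>(a, b) \<in> P. \<Union>(c, d) \<in> Q. groth_rel R `` {f a b c d}) =
      (\<Union>(a, b) \<in> map_prod \<phi> \<phi> ` P. \<Union>(c, d) \<in> map_prod \<phi> \<phi> ` Q. groth_rel S `` {g a b c d})"
  using assms by (simp add: image_UN case_prod_beta)

text \<open>The Grothendieck classes are treated as plain sets of pairs, mapped elementwise. In this form
  neither well-definedness of the operations nor any semiring axiom is needed.\<close>

lemma grothendieck_ring_iso_RDirProd_list:
  fixes R :: "('a, 'r) ring_scheme" and Q :: "'i \<Rightarrow> ('b, 's) ring_scheme"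
  assumes closed: "\<zero>\<^bsub>R\<^esub> \<in> carrier R" "\<one>\<^bsub>R\<^esub> \<in> carrier R"
      "\<And>a b. \<lbrakk>a \<in> carrier R; b \<in> carrier R\<rbrakk> \<Longrightarrow> a \<oplus>\<^bsub>R\<^esub> b \<in> carrier R"
      "\<And>a b. \<lbrakk>a \<in> carrier R; b \<in> carrier R\<rbrakk> \<Longrightarrow> a \<otimes>\<^bsub>R\<^esub> b \<in> carrier R"
    and hom: "\<And>i. i \<in> set is \<Longrightarrow> \<phi> i \<in> ring_hom R (Q i)"
    and zero: "\<And>i. i \<in> set is \<Longrightarrow> \<phi> i \<zero>\<^bsub>R\<^esub> = \<zero>\<^bsub>Q i\<^esub>"
    and inj: "\<And>a b. \<lbrakk>a \<in> carrier R; b \<in> carrier R; \<And>i. i \<in> set is \<Longrightarrow> \<phi> i a = \<phi> i b\<rbrakk> \<Longrightarrow> a = b"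
    and surj: "\<And>r. (\<And>i. i \<in> set is \<Longrightarrow> r i \<in> carrier (Q i)) \<Longrightarrow>
      \<exists>a \<in> carrier R. \<forall>i \<in> set is. \<phi> i a = r i"
    and dist: "distinct is"
  shows "grothendieck_ring R \<simeq> RDirProd_list (map (\<lambda>i. grothendieck_ring (Q i)) is)"
proof -
  note hom_simps = ring_hom_closed[OF hom] ring_hom_mult[OF hom] ring_hom_add[OF hom] ring_hom_one[OF hom]
  \<comment> \<open>The image is the full class, not just a part of it; this is what makes the
    elementwise map land in the Grothendieck ring of \<open>Q i\<close>.\<close>
  have img: "map_prod (\<phi> i) (\<phi> i) ` groth_rel R `` {(a, b)} = groth_rel (Q i) `` {(\<phi> i a, \<phi> i b)}"
    if i: "i \<in> set is" and ab: "a \<in> carrier R" "b \<in> carrier R" for i a b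
  proof (intro subset_antisym subsetI)
    fix p assume "p \<in> map_prod (\<phi> i) (\<phi> i) ` groth_rel R `` {(a, b)}"
    then obtain a' b' c where p: "p = (\<phi> i a', \<phi> i b')" and car: "a' \<in> carrier R" "b' \<in> carrier R" "c \<in> carrier R"
      and eq: "(a \<oplus>\<^bsub>R\<^esub> b') \<oplus>\<^bsub>R\<^esub> c = (a' \<oplus>\<^bsub>R\<^esub> b) \<oplus>\<^bsub>R\<^esub> c"
      by (auto simp: groth_rel_Image)
    have "\<phi> i ((a \<oplus>\<^bsub>R\<^esub> b') \<oplus>\<^bsub>R\<^esub> c) = \<phi> i ((a' \<oplus>\<^bsub>R\<^esub> b) \<oplus>\<^bsub>R\<^esub> c)"
      using eq by simp
    then have "(\<phi> i a \<oplus>\<^bsub>Q i\<^esub> \<phi> i b') \<oplus>\<^bsub>Q i\<^esub> \<phi> i c = (\<phi> i a' \<oplus>\<^bsub>Q i\<^esub> \<phi> i b) \<oplus>\<^bsub>Q i\<^esub> \<phi> i c"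
      using i ab car by (simp add: hom_simps closed)
    then show "p \<in> groth_rel (Q i) `` {(\<phi> i a, \<phi> i b)}"
      using i ab car by (auto simp: p groth_rel_Image hom_simps)
  next
    fix p assume "p \<in> groth_rel (Q i) `` {(\<phi> i a, \<phi> i b)}"
    then obtain a' b' c' where p: "p = (a', b')"
      and car: "a' \<in> carrier (Q i)" "b' \<in> carrier (Q i)" "c' \<in> carrier (Q i)"
      and eq: "(\<phi> i a \<oplus>\<^bsub>Q i\<^esub> b') \<oplus>\<^bsub>Q i\<^esub> c' = (a' \<oplus>\<^bsub>Q i\<^esub> \<phi> i b) \<oplus>\<^bsub>Q i\<^esub> c'"
      by (auto simp: groth_rel_Image)
    \<comment> \<open>Coordinate \<open>i\<close> is prescribed and the others are copied from
      \<open>x\<close>. With \<open>a''\<close> and \<open>b''\<close> copied from \<open>a\<close>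
      and \<open>b\<close>, the relation to be proved has identical sides in every coordinate other
      than \<open>i\<close>, whatever \<open>c''\<close> is there; in coordinate \<open>i\<close> it
      is \<open>eq\<close>.\<close>
    have lift: "\<exists>y \<in> carrier R. \<forall>j \<in> set is. \<phi> j y = (if j = i then y' else \<phi> j x)"
      if "x \<in> carrier R" "y' \<in> carrier (Q i)" for x y'
      using that by (intro surj) (auto simp: hom_simps)
    obtain a'' where a'': "a'' \<in> carrier R" "\<And>j. j \<in> set is \<Longrightarrow> \<phi> j a'' = (if j = i then a' else \<phi> j a)"
      using lift[OF ab(1) car(1)] by blast
    obtain b'' where b'': "b'' \<in> carrier R" "\<And>j. j \<in> set is \<Longrightarrow> \<phi> j b'' = (if j = i then b' else \<phi> j b)"
      using lift[OF ab(2) car(2)] by blast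
    obtain c'' where c'': "c'' \<in> carrier R" "\<And>j. j \<in> set is \<Longrightarrow> \<phi> j c'' = (if j = i then c' else \<phi> j a)"
      using lift[OF ab(1) car(3)] by blast
    have "(a \<oplus>\<^bsub>R\<^esub> b'') \<oplus>\<^bsub>R\<^esub> c'' = (a'' \<oplus>\<^bsub>R\<^esub> b) \<oplus>\<^bsub>R\<^esub> c''"
      using ab a'' b'' c'' eq by (intro inj) (auto simp: hom_simps closed)
    then have "(a'', b'') \<in> groth_rel R `` {(a, b)}"
      using ab a'' b'' c'' by (auto simp: groth_rel_Image)
    moreover have "p = map_prod (\<phi> i) (\<phi> i) (a'', b'')"
      using a'' b'' i by (simp add: p)
    ultimately show "p \<in> map_prod (\<phi> i) (\<phi> i) ` groth_rel R `` {(a, b)}"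
      by blast
  qed
  \<comment> \<open>A class consists of all pairs that lie in its image in every coordinate, so it
    is determined by these images. This becomes injectivity of \<open>h\<close>.\<close>
  have mem: "p \<in> P \<longleftrightarrow> p \<in> carrier R \<times> carrier R \<and> (\<forall>i \<in> set is. map_prod (\<phi> i) (\<phi> i) p \<in> map_prod (\<phi> i) (\<phi> i) ` P)"
    if "P \<in> carrier (grothendieck_ring R)" for P p
  proof -
    from that obtain a b where P: "P = groth_rel R `` {(a, b)}" and ab: "a \<in> carrier R" "b \<in> carrier R"
      by (auto simp: grothendieck_ring_def elim!: quotientE)
    show ?thesis
    proof (intro iffI conjI)
      assume p: "p \<in> carrier R \<times> carrier R \<and> (\<forall>i \<in> set is. map_prod (\<phi> i) (\<phi> i) p \<in> map_prod (\<phi> i) (\<phi> i) ` P)"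
      obtain a' b' where p_eq: "p = (a', b')" and car: "a' \<in> carrier R" "b' \<in> carrier R"
        using p by blast
      have "\<forall>i \<in> set is. \<exists>c \<in> carrier (Q i).
          (\<phi> i a \<oplus>\<^bsub>Q i\<^esub> \<phi> i b') \<oplus>\<^bsub>Q i\<^esub> c = (\<phi> i a' \<oplus>\<^bsub>Q i\<^esub> \<phi> i b) \<oplus>\<^bsub>Q i\<^esub> c"
      proof
        fix i assume i: "i \<in> set is"
        have "map_prod (\<phi> i) (\<phi> i) p \<in> groth_rel (Q i) `` {(\<phi> i a, \<phi> i b)}"
          unfolding img[OF i ab, symmetric] using p i P by blast
        then show "\<exists>c \<in> carrier (Q i).
          (\<phi> i a \<oplus>\<^bsub>Q i\<^esub> \<phi> i b') \<oplus>\<^bsub>Q i\<^esub> c = (\<phi> i a' \<oplus>\<^bsub>Q i\<^esub> \<phi> i b) \<oplus>\<^bsub>Q i\<^esub> c"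
          by (simp add: groth_rel_Image p_eq)
      qed
      \<comment> \<open>The cancelling summands found separately in the factors are the coordinates
        of one summand \<open>c\<close>.\<close>
      then obtain r where r: "\<forall>i \<in> set is. r i \<in> carrier (Q i) \<and>
          (\<phi> i a \<oplus>\<^bsub>Q i\<^esub> \<phi> i b') \<oplus>\<^bsub>Q i\<^esub> r i = (\<phi> i a' \<oplus>\<^bsub>Q i\<^esub> \<phi> i b) \<oplus>\<^bsub>Q i\<^esub> r i"
        by (metis bchoice)
      then obtain c where c: "c \<in> carrier R" "\<forall>i \<in> set is. \<phi> i c = r i"
        using surj[of r] by blast
      have "(a \<oplus>\<^bsub>R\<^esub> b') \<oplus>\<^bsub>R\<^esub> c = (a' \<oplus>\<^bsub>R\<^esub> b) \<oplus>\<^bsub>R\<^esub> c"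
        using ab car c r by (intro inj) (auto simp: hom_simps closed)
      then show "p \<in> P"
        using ab car c by (auto simp: P p_eq groth_rel_Image)
    qed (use P in \<open>auto simp: groth_rel_Image\<close>)
  qed
  have sub: "P \<subseteq> carrier R \<times> carrier R" if "P \<in> carrier (grothendieck_ring R)" for P
    using mem[OF that] by blast
  define h where "h P = map (\<lambda>i. map_prod (\<phi> i) (\<phi> i) ` P) is" for P
  have "h \<in> ring_hom (grothendieck_ring R) (RDirProd_list (map (\<lambda>i. grothendieck_ring (Q i)) is))"
    unfolding h_def
  proof (rule map_in_ring_hom_RDirProd_list, rule ring_hom_memI)
    fix i P assume i: "i \<in> set is" and P: "P \<in> carrier (grothendieck_ring R)"
    then obtain a b where "P = groth_rel R `` {(a, b)}" "a \<in> carrier R" "b \<in> carrier R"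
      by (auto simp: grothendieck_ring_def elim!: quotientE)
    then show "map_prod (\<phi> i) (\<phi> i) ` P \<in> carrier (grothendieck_ring (Q i))"
      using i by (auto simp: img grothendieck_ring_def hom_simps intro!: quotientI)
    fix P' assume P': "P' \<in> carrier (grothendieck_ring R)"
    show "map_prod (\<phi> i) (\<phi> i) ` (P \<otimes>\<^bsub>grothendieck_ring R\<^esub> P') =
        map_prod (\<phi> i) (\<phi> i) ` P \<otimes>\<^bsub>grothendieck_ring (Q i)\<^esub> map_prod (\<phi> i) (\<phi> i) ` P'"
      unfolding grothendieck_ring_def monoid.simps
    proof (rule map_prod_image_groth_mult)
      fix a b c d assume "(a, b) \<in> P" "(c, d) \<in> P'"
      then have "a \<in> carrier R" "b \<in> carrier R" "c \<in> carrier R" "d \<in> carrier R"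
        using sub[OF P] sub[OF P'] by auto
      then show "map_prod (\<phi> i) (\<phi> i) ` groth_rel R `` {(a \<otimes>\<^bsub>R\<^esub> c \<oplus>\<^bsub>R\<^esub> b \<otimes>\<^bsub>R\<^esub> d, a \<otimes>\<^bsub>R\<^esub> d \<oplus>\<^bsub>R\<^esub> b \<otimes>\<^bsub>R\<^esub> c)} =
        groth_rel (Q i) `` {(\<phi> i a \<otimes>\<^bsub>Q i\<^esub> \<phi> i c \<oplus>\<^bsub>Q i\<^esub> \<phi> i b \<otimes>\<^bsub>Q i\<^esub> \<phi> i d, \<phi> i a \<otimes>\<^bsub>Q i\<^esub> \<phi> i d \<oplus>\<^bsub>Q i\<^esub> \<phi> i b \<otimes>\<^bsub>Q i\<^esub> \<phi> i c)}"
        using i by (simp add: img closed hom_simps)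
    qed
    show "map_prod (\<phi> i) (\<phi> i) ` (P \<oplus>\<^bsub>grothendieck_ring R\<^esub> P') =
        map_prod (\<phi> i) (\<phi> i) ` P \<oplus>\<^bsub>grothendieck_ring (Q i)\<^esub> map_prod (\<phi> i) (\<phi> i) ` P'"
      unfolding grothendieck_ring_def ring.simps
    proof (rule map_prod_image_groth_mult)
      fix a b c d assume "(a, b) \<in> P" "(c, d) \<in> P'"
      then have "a \<in> carrier R" "b \<in> carrier R" "c \<in> carrier R" "d \<in> carrier R"
        using sub[OF P] sub[OF P'] by auto
      then show "map_prod (\<phi> i) (\<phi> i) ` groth_rel R `` {(a \<oplus>\<^bsub>R\<^esub> c, b \<oplus>\<^bsub>R\<^esub> d)} =
        groth_rel (Q i) `` {(\<phi> i a \<oplus>\<^bsub>Q i\<^esub> \<phi> i c, \<phi> i b \<oplus>\<^bsub>Q i\<^esub> \<phi> i d)}"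
        using i by (simp add: img closed hom_simps)
    qed
  next
    fix i assume "i \<in> set is"
    then show "map_prod (\<phi> i) (\<phi> i) ` \<one>\<^bsub>grothendieck_ring R\<^esub> = \<one>\<^bsub>grothendieck_ring (Q i)\<^esub>"
      by (simp add: grothendieck_ring_def img closed hom_simps zero)
  qed
  moreover have "bij_betw h (carrier (grothendieck_ring R))
      (carrier (RDirProd_list (map (\<lambda>i. grothendieck_ring (Q i)) is)))"
    unfolding bij_betw_def
  proof (intro conjI subset_antisym)
    show "inj_on h (carrier (grothendieck_ring R))"
    proof (rule inj_onI)
      fix P P' assume P: "P \<in> carrier (grothendieck_ring R)" "P' \<in> carrier (grothendieck_ring R)" and "h P = h P'"
      then have "\<forall>i \<in> set is. map_prod (\<phi> i) (\<phi> i) ` P = map_prod (\<phi> i) (\<phi> i) ` P'"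
        by (simp add: h_def)
      then show "P = P'"
        unfolding set_eq_iff mem[OF P(1)] mem[OF P(2)] by simp
    qed
    show "h ` carrier (grothendieck_ring R) \<subseteq> carrier (RDirProd_list (map (\<lambda>i. grothendieck_ring (Q i)) is))"
      using calculation by (auto dest: ring_hom_closed)
    show "carrier (RDirProd_list (map (\<lambda>i. grothendieck_ring (Q i)) is)) \<subseteq> h ` carrier (grothendieck_ring R)"
    proof
      fix Ps assume Ps: "Ps \<in> carrier (RDirProd_list (map (\<lambda>i. grothendieck_ring (Q i)) is))"
      have len: "length Ps = length is"
        using RDirProd_list_carrier_mem(1)[OF Ps] by simp
      \<comment> \<open>The tuple is read as a function of the index, which is unambiguous because
        \<open>is\<close> is distinct.\<close>
      define P where "P i = the (map_of (zip is Ps) i)" for i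
      have P_nth: "P (is ! k) = Ps ! k" if "k < length is" for k
        using that len dist by (simp add: P_def map_of_zip_nth)
      have Ps_eq: "Ps = map P is"
        by (rule nth_equalityI) (simp_all add: len P_nth)
      have "\<forall>i \<in> set is. \<exists>p. P i = groth_rel (Q i) `` {p} \<and> p \<in> carrier (Q i) \<times> carrier (Q i)"
      proof
        fix i assume "i \<in> set is"
        then obtain k where "k < length is" "i = is ! k"
          by (metis in_set_conv_nth)
        then have "P i \<in> carrier (grothendieck_ring (Q i))"
          using RDirProd_list_carrier_mem(2)[OF Ps, of k] by (simp add: P_nth)
        then show "\<exists>p. P i = groth_rel (Q i) `` {p} \<and> p \<in> carrier (Q i) \<times> carrier (Q i)"
          by (auto simp: grothendieck_ring_def elim!: quotientE)
      qed
      then obtain p where p: "\<And>i. i \<in> set is \<Longrightarrow> P i = groth_rel (Q i) `` {p i}"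
          "\<And>i. i \<in> set is \<Longrightarrow> p i \<in> carrier (Q i) \<times> carrier (Q i)"
        by metis
      obtain a where a: "a \<in> carrier R" "\<forall>i \<in> set is. \<phi> i a = fst (p i)"
        using surj[of "\<lambda>i. fst (p i)"] p(2) by fastforce
      obtain b where b: "b \<in> carrier R" "\<forall>i \<in> set is. \<phi> i b = snd (p i)"
        using surj[of "\<lambda>i. snd (p i)"] p(2) by fastforce
      have "h (groth_rel R `` {(a, b)}) = Ps"
        using a b p(1) by (simp add: h_def Ps_eq img)
      moreover have "groth_rel R `` {(a, b)} \<in> carrier (grothendieck_ring R)"
        using a b by (simp add: grothendieck_ring_def quotientI)
      ultimately show "Ps \<in> h ` carrier (grothendieck_ring R)"
        by blast
    qed
  qed
  ultimately show ?thesis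
    by (auto simp: is_ring_iso_def ring_iso_def)
qed

section \<open>\<open>C\<close>-sets\<close>

lemma is_csetD:
  assumes "is_cset C X"
  shows finite_pts: "x \<in> Obj C \<Longrightarrow> finite (pts X x)"
    and act_in: "\<lbrakk>f \<in> Arr C; a \<in> pts X (Dom C f)\<rbrakk> \<Longrightarrow> act X f a \<in> pts X (Cod C f)"
    and act_Id: "\<lbrakk>x \<in> Obj C; a \<in> pts X x\<rbrakk> \<Longrightarrow> act X (Id C x) a = a"
    and act_Comp: "\<lbrakk>f \<in> Arr C; g \<in> Arr C; Cod C f = Dom C g; a \<in> pts X (Dom C f)\<rbrakk> \<Longrightarrow>
      act X (Comp C g f) a = act X g (act X f a)"
  using assms unfolding is_cset_def by (auto 0 3 simp: PiE_iff)

text \<open>Off the objects and arrows both functors have the default values fixed by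
  \<open>is_cset\<close>, and on arrows both actions are extensional.\<close>

lemma cset_eqI:
  assumes X: "is_cset C X" and Y: "is_cset C Y"
    and pts: "\<And>x. x \<in> Obj C \<Longrightarrow> pts X x = pts Y x"
    and act: "\<And>f a. \<lbrakk>f \<in> Arr C; a \<in> pts X (Dom C f)\<rbrakk> \<Longrightarrow> act X f a = act Y f a"
    and "category C"
  shows "X = Y"
proof -
  interpret category C by fact
  have "pts X x = pts Y x" for x
    using X Y pts unfolding is_cset_def by (cases "x \<in> Obj C") auto
  then have "pts X = pts Y" ..
  moreover have "act X f = act Y f" for f
  proof (cases "f \<in> Arr C")
    case True
    then have "act X f \<in> extensional (pts X (Dom C f))" "act Y f \<in> extensional (pts X (Dom C f))"
      using X Y calculation unfolding is_cset_def PiE_def by auto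
    then show ?thesis
      using act True by (intro extensionalityI) auto
  next
    case False
    then show ?thesis
      using X Y unfolding is_cset_def by auto
  qed
  then have "act X = act Y" ..
  ultimately show ?thesis
    by simp
qed

lemma pts_mk_cset [simp]: "x \<in> Obj C \<Longrightarrow> pts (mk_cset C A \<phi>) x = A x"
  by (simp add: mk_cset_def)

lemma act_mk_cset [simp]: "\<lbrakk>f \<in> Arr C; a \<in> A (Dom C f)\<rbrakk> \<Longrightarrow> act (mk_cset C A \<phi>) f a = \<phi> f a"
  by (simp add: mk_cset_def)

context category
begin

lemma is_cset_mk_cset:
  assumes "\<And>x. x \<in> Obj C \<Longrightarrow> finite (A x)"
    and "\<And>f a. \<lbrakk>f \<in> Arr C; a \<in> A (Dom C f)\<rbrakk> \<Longrightarrow> \<phi> f a \<in> A (Cod C f)"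
    and "\<And>x a. \<lbrakk>x \<in> Obj C; a \<in> A x\<rbrakk> \<Longrightarrow> \<phi> (Id C x) a = a"
    and "\<And>f g a. \<lbrakk>f \<in> Arr C; g \<in> Arr C; Cod C f = Dom C g; a \<in> A (Dom C f)\<rbrakk> \<Longrightarrow>
      \<phi> (Comp C g f) a = \<phi> g (\<phi> f a)"
  shows "is_cset C (mk_cset C A \<phi>)"
proof -
  have "\<phi> f a \<in> A (Dom C g)" if "f \<in> Arr C" "Cod C f = Dom C g" "a \<in> A (Dom C f)" for f g a
    using assms(2)[of f a] that by simp
  with assms show ?thesis
    by (auto simp: is_cset_def mk_cset_def PiE_iff Dom_in Cod_in Id_in Dom_Id Comp_in Dom_Comp)
qed

lemma is_cset_sub:
  assumes "is_cset C X" and "\<And>x. x \<in> Obj C \<Longrightarrow> A x \<subseteq> pts X x"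
    and "\<And>f a. \<lbrakk>f \<in> Arr C; a \<in> A (Dom C f)\<rbrakk> \<Longrightarrow> act X f a \<in> A (Cod C f)"
  shows "is_cset C (mk_cset C A (act X))"
proof (rule is_cset_mk_cset)
  show "finite (A x)" if "x \<in> Obj C" for x
    using assms that by (meson finite_pts finite_subset)
qed (use assms in \<open>auto simp: act_Id[OF assms(1)] act_Comp[OF assms(1)] Dom_in subset_iff\<close>)

lemma csubset_mk_cset:
  assumes "is_cset C X" and "\<And>x. x \<in> Obj C \<Longrightarrow> A x \<subseteq> pts X x"
    and "\<And>f a. \<lbrakk>f \<in> Arr C; a \<in> A (Dom C f)\<rbrakk> \<Longrightarrow> act X f a \<in> A (Cod C f)"
  shows "csubset C (mk_cset C A (act X)) X"
  using is_cset_sub[OF assms] assms(2) by (simp add: csubset_def Dom_in)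

lemma is_cset_empty: "is_cset C (empty_cset C)"
  unfolding empty_cset_def by (rule is_cset_mk_cset) auto

lemma eq_empty_cset_iff: "is_cset C X \<Longrightarrow> X = empty_cset C \<longleftrightarrow> (\<forall>x \<in> Obj C. pts X x = {})"
  by (auto intro!: cset_eqI is_cset_empty category_axioms simp: Dom_in) (auto simp: empty_cset_def Dom_in)

lemma is_cset_one: "is_cset C (one_cset C)"
  unfolding one_cset_def by (rule is_cset_mk_cset) auto

lemma is_cset_prod: "\<lbrakk>is_cset C X; is_cset C Y\<rbrakk> \<Longrightarrow> is_cset C (prod_cset C X Y)"
  unfolding prod_cset_def
  by (rule is_cset_mk_cset) (auto simp: finite_pts act_in act_Id act_Comp)

lemma is_cset_sum: "\<lbrakk>is_cset C X; is_cset C Y\<rbrakk> \<Longrightarrow> is_cset C (sum_cset C X Y)"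
  unfolding sum_cset_def
  by (rule is_cset_mk_cset) (auto simp: finite_pts act_in act_Id act_Comp)

lemma is_cset_disjoint_union:
  "\<lbrakk>finite I; \<And>i. i \<in> I \<Longrightarrow> is_cset C (X i)\<rbrakk> \<Longrightarrow> is_cset C (disjoint_union_cset C I X)"
  unfolding disjoint_union_cset_def
  by (rule is_cset_mk_cset) (auto simp: finite_pts act_in act_Id act_Comp intro!: finite_SigmaI finite_pts)

end

lemma pts_prod_cset [simp]: "x \<in> Obj C \<Longrightarrow> pts (prod_cset C X Y) x = pts X x \<times> pts Y x"
  by (simp add: prod_cset_def)

lemma act_prod_cset [simp]:
  "\<lbrakk>f \<in> Arr C; a \<in> pts X (Dom C f); b \<in> pts Y (Dom C f)\<rbrakk> \<Longrightarrow>
    act (prod_cset C X Y) f (a, b) = (act X f a, act Y f b)"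
  by (simp add: prod_cset_def)

lemma pts_sum_cset [simp]: "x \<in> Obj C \<Longrightarrow> pts (sum_cset C X Y) x = pts X x <+> pts Y x"
  by (simp add: sum_cset_def)

lemma act_sum_cset [simp]:
  "\<lbrakk>f \<in> Arr C; a \<in> pts X (Dom C f)\<rbrakk> \<Longrightarrow> act (sum_cset C X Y) f (Inl a) = Inl (act X f a)"
  "\<lbrakk>f \<in> Arr C; b \<in> pts Y (Dom C f)\<rbrakk> \<Longrightarrow> act (sum_cset C X Y) f (Inr b) = Inr (act Y f b)"
  by (auto simp: sum_cset_def InlI InrI)

lemma pts_disjoint_union_cset [simp]:
  "x \<in> Obj C \<Longrightarrow> pts (disjoint_union_cset C I X) x = (SIGMA i:I. pts (X i) x)"
  by (simp add: disjoint_union_cset_def)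

lemma act_disjoint_union_cset [simp]:
  "\<lbrakk>f \<in> Arr C; i \<in> I; a \<in> pts (X i) (Dom C f)\<rbrakk> \<Longrightarrow>
    act (disjoint_union_cset C I X) f (i, a) = (i, act (X i) f a)"
  by (simp add: disjoint_union_cset_def)

section \<open>Isomorphisms\<close>

text \<open>Naturality is asked of \<open>\<eta>\<close> only. That of the pointwise inverse
  \<open>\<theta>\<close> follows by applying \<open>\<theta>\<close> to the naturality square of
  \<open>\<eta>\<close> at \<open>\<theta> (Dom C f) b\<close>.\<close>

lemma iso_csetI:
  assumes "\<And>x a. \<lbrakk>x \<in> Obj C; a \<in> pts X x\<rbrakk> \<Longrightarrow> \<eta> x a \<in> pts Y x \<and> \<theta> x (\<eta> x a) = a"
    and "\<And>x b. \<lbrakk>x \<in> Obj C; b \<in> pts Y x\<rbrakk> \<Longrightarrow> \<theta> x b \<in> pts X x \<and> \<eta> x (\<theta> x b) = b"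
    and nat: "\<And>f a. \<lbrakk>f \<in> Arr C; a \<in> pts X (Dom C f)\<rbrakk> \<Longrightarrow> \<eta> (Cod C f) (act X f a) = act Y f (\<eta> (Dom C f) a)"
    and "category C" "is_cset C X"
  shows "iso_cset C X Y"
proof -
  interpret category C by fact
  have "\<theta> (Cod C f) (act Y f b) = act X f (\<theta> (Dom C f) b)" if "f \<in> Arr C" "b \<in> pts Y (Dom C f)" for f b
    using assms(1,2) nat[OF that(1), of "\<theta> (Dom C f) b"] that act_in[OF \<open>is_cset C X\<close>] Dom_in Cod_in by metis
  with assms show ?thesis
    unfolding iso_cset_def nat_trans_def by (intro exI[of _ \<eta>] exI[of _ \<theta>]) auto
qed

lemma iso_csetE:
  assumes "iso_cset C X Y"
  obtains \<eta> \<theta> where "nat_trans C X Y \<eta>" "nat_trans C Y X \<theta>"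
    "\<And>x a. \<lbrakk>x \<in> Obj C; a \<in> pts X x\<rbrakk> \<Longrightarrow> \<theta> x (\<eta> x a) = a"
    "\<And>x b. \<lbrakk>x \<in> Obj C; b \<in> pts Y x\<rbrakk> \<Longrightarrow> \<eta> x (\<theta> x b) = b"
  using assms unfolding iso_cset_def by blast

lemma nat_transD:
  assumes "nat_trans C X Y \<eta>"
  shows nat_trans_in: "\<lbrakk>x \<in> Obj C; a \<in> pts X x\<rbrakk> \<Longrightarrow> \<eta> x a \<in> pts Y x"
    and nat_trans_act: "\<lbrakk>f \<in> Arr C; a \<in> pts X (Dom C f)\<rbrakk> \<Longrightarrow> \<eta> (Cod C f) (act X f a) = act Y f (\<eta> (Dom C f) a)"
  using assms unfolding nat_trans_def by auto

lemma nat_transI: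
  assumes "\<And>x a. \<lbrakk>x \<in> Obj C; a \<in> pts X x\<rbrakk> \<Longrightarrow> \<eta> x a \<in> pts Y x"
    and "\<And>f a. \<lbrakk>f \<in> Arr C; a \<in> pts X (Dom C f)\<rbrakk> \<Longrightarrow> \<eta> (Cod C f) (act X f a) = act Y f (\<eta> (Dom C f) a)"
  shows "nat_trans C X Y \<eta>"
  using assms unfolding nat_trans_def by auto

lemma iso_cset_refl: "iso_cset C X X"
  unfolding iso_cset_def nat_trans_def by (intro exI[of _ "\<lambda>x a. a"]) auto

lemma iso_cset_sym: "iso_cset C X Y \<Longrightarrow> iso_cset C Y X"
  unfolding iso_cset_def by blast

lemma iso_cset_trans:
  assumes "category C" "iso_cset C X Y" "iso_cset C Y Z"
  shows "iso_cset C X Z"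
proof -
  interpret category C by fact
  obtain \<eta> \<theta> where 1: "nat_trans C X Y \<eta>" "nat_trans C Y X \<theta>"
    "\<And>x a. \<lbrakk>x \<in> Obj C; a \<in> pts X x\<rbrakk> \<Longrightarrow> \<theta> x (\<eta> x a) = a"
    "\<And>x b. \<lbrakk>x \<in> Obj C; b \<in> pts Y x\<rbrakk> \<Longrightarrow> \<eta> x (\<theta> x b) = b"
    using iso_csetE[OF assms(2)] by metis
  obtain \<eta>' \<theta>' where 2: "nat_trans C Y Z \<eta>'" "nat_trans C Z Y \<theta>'"
    "\<And>x a. \<lbrakk>x \<in> Obj C; a \<in> pts Y x\<rbrakk> \<Longrightarrow> \<theta>' x (\<eta>' x a) = a"
    "\<And>x b. \<lbrakk>x \<in> Obj C; b \<in> pts Z x\<rbrakk> \<Longrightarrow> \<eta>' x (\<theta>' x b) = b"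
    using iso_csetE[OF assms(3)] by metis
  show ?thesis
    unfolding iso_cset_def
  proof (intro exI conjI)
    show "nat_trans C X Z (\<lambda>x a. \<eta>' x (\<eta> x a))"
      using 1(1) 2(1) by (auto simp: nat_trans_def Pi_iff Dom_in)
    show "nat_trans C Z X (\<lambda>x a. \<theta> x (\<theta>' x a))"
      using 1(2) 2(2) by (auto simp: nat_trans_def Pi_iff Dom_in)
  qed (use 1 2 in \<open>auto simp: nat_trans_in[OF 1(1)] nat_trans_in[OF 2(2)]\<close>)
qed

lemma iso_cset_prod:
  assumes "category C" "iso_cset C X X'" "iso_cset C Y Y'"
  shows "iso_cset C (prod_cset C X Y) (prod_cset C X' Y')"
proof -
  interpret category C by fact
  obtain \<eta> \<theta> where 1: "nat_trans C X X' \<eta>" "nat_trans C X' X \<theta>"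
    "\<And>x a. \<lbrakk>x \<in> Obj C; a \<in> pts X x\<rbrakk> \<Longrightarrow> \<theta> x (\<eta> x a) = a"
    "\<And>x b. \<lbrakk>x \<in> Obj C; b \<in> pts X' x\<rbrakk> \<Longrightarrow> \<eta> x (\<theta> x b) = b"
    using iso_csetE[OF assms(2)] by metis
  obtain \<eta>' \<theta>' where 2: "nat_trans C Y Y' \<eta>'" "nat_trans C Y' Y \<theta>'"
    "\<And>x a. \<lbrakk>x \<in> Obj C; a \<in> pts Y x\<rbrakk> \<Longrightarrow> \<theta>' x (\<eta>' x a) = a"
    "\<And>x b. \<lbrakk>x \<in> Obj C; b \<in> pts Y' x\<rbrakk> \<Longrightarrow> \<eta>' x (\<theta>' x b) = b"
    using iso_csetE[OF assms(3)] by metis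
  have nt: "nat_trans C (prod_cset C A B) (prod_cset C A' B') (\<lambda>x. map_prod (\<zeta> x) (\<xi> x))"
    if "nat_trans C A A' \<zeta>" "nat_trans C B B' \<xi>" for A A' B B' \<zeta> \<xi>
    by (rule nat_transI)
      (auto simp: Dom_in Cod_in nat_trans_in[OF that(1)] nat_trans_in[OF that(2)]
        nat_trans_act[OF that(1)] nat_trans_act[OF that(2)])
  show ?thesis
    unfolding iso_cset_def
  proof (intro exI conjI)
    show "nat_trans C (prod_cset C X Y) (prod_cset C X' Y') (\<lambda>x. map_prod (\<eta> x) (\<eta>' x))"
      by (rule nt[OF 1(1) 2(1)])
    show "nat_trans C (prod_cset C X' Y') (prod_cset C X Y) (\<lambda>x. map_prod (\<theta> x) (\<theta>' x))"
      by (rule nt[OF 1(2) 2(2)])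
  qed (auto simp: 1(3,4) 2(3,4))
qed

lemma iso_cset_sum:
  assumes "category C" "iso_cset C X X'" "iso_cset C Y Y'"
  shows "iso_cset C (sum_cset C X Y) (sum_cset C X' Y')"
proof -
  interpret category C by fact
  obtain \<eta> \<theta> where 1: "nat_trans C X X' \<eta>" "nat_trans C X' X \<theta>"
    "\<And>x a. \<lbrakk>x \<in> Obj C; a \<in> pts X x\<rbrakk> \<Longrightarrow> \<theta> x (\<eta> x a) = a"
    "\<And>x b. \<lbrakk>x \<in> Obj C; b \<in> pts X' x\<rbrakk> \<Longrightarrow> \<eta> x (\<theta> x b) = b"
    using iso_csetE[OF assms(2)] by metis
  obtain \<eta>' \<theta>' where 2: "nat_trans C Y Y' \<eta>'" "nat_trans C Y' Y \<theta>'"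
    "\<And>x a. \<lbrakk>x \<in> Obj C; a \<in> pts Y x\<rbrakk> \<Longrightarrow> \<theta>' x (\<eta>' x a) = a"
    "\<And>x b. \<lbrakk>x \<in> Obj C; b \<in> pts Y' x\<rbrakk> \<Longrightarrow> \<eta>' x (\<theta>' x b) = b"
    using iso_csetE[OF assms(3)] by metis
  have nt: "nat_trans C (sum_cset C A B) (sum_cset C A' B') (\<lambda>x. map_sum (\<zeta> x) (\<xi> x))"
    if "nat_trans C A A' \<zeta>" "nat_trans C B B' \<xi>" for A A' B B' \<zeta> \<xi>
    by (rule nat_transI)
      (auto simp: Dom_in Cod_in nat_trans_in[OF that(1)] nat_trans_in[OF that(2)]
        nat_trans_act[OF that(1)] nat_trans_act[OF that(2)])
  show ?thesis
    unfolding iso_cset_def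
  proof (intro exI conjI)
    show "nat_trans C (sum_cset C X Y) (sum_cset C X' Y') (\<lambda>x. map_sum (\<eta> x) (\<eta>' x))"
      by (rule nt[OF 1(1) 2(1)])
    show "nat_trans C (sum_cset C X' Y') (sum_cset C X Y) (\<lambda>x. map_sum (\<theta> x) (\<theta>' x))"
      by (rule nt[OF 1(2) 2(2)])
  qed (auto simp: 1(3,4) 2(3,4))
qed

lemma iso_class_cong:
  assumes "category C" "iso_cset C X Y"
  shows "iso_class C X = iso_class C Y"
  using iso_cset_trans[OF assms(1,2)] iso_cset_trans[OF assms(1) iso_cset_sym[OF assms(2)]]
  unfolding iso_class_def by auto

lemma self_in_iso_class: "is_cset C X \<Longrightarrow> X \<in> iso_class C X"
  by (simp add: iso_class_def iso_cset_refl)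

text \<open>A class retains only members over \<open>nat\<close>, so \<open>Y\<close> has to live
  there in order to belong to its own class.\<close>

lemma iso_class_eqD:
  fixes Y :: "('o, 'm, nat) cset"
  assumes "is_cset C Y" "iso_class C X = iso_class C Y"
  shows "iso_cset C X Y"
proof -
  have "Y \<in> iso_class C X"
    using assms by (simp add: self_in_iso_class)
  then show ?thesis
    by (simp add: iso_class_def)
qed

text \<open>Transport of structure. Injectivity on the union of all values, rather than on each
  value, lets one inverse \<open>g\<close> serve every object.\<close>

lemma iso_cset_of_inj:
  fixes X :: "('o, 'm, 'a) cset" and h :: "'a \<Rightarrow> 'b"
  assumes "category C" "is_cset C X" "inj_on h (\<Union>x \<in> Obj C. pts X x)"
  shows "\<exists>Y :: ('o, 'm, 'b) cset. is_cset C Y \<and> iso_cset C X Y"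
proof -
  interpret category C by fact
  define g where "g = the_inv_into (\<Union>x \<in> Obj C. pts X x) h"
  have g: "g (h a) = a" if "x \<in> Obj C" "a \<in> pts X x" for x a
    unfolding g_def by (rule the_inv_into_f_f) (use assms that in auto)
  have g_act: "g (h a) = a" "g (h (act X f a)) = act X f a" if "f \<in> Arr C" "a \<in> pts X (Dom C f)" for f a
    using that g[OF Dom_in] g[OF Cod_in] act_in[OF assms(2)] by auto
  define Y where "Y = mk_cset C (\<lambda>x. h ` pts X x) (\<lambda>f b. h (act X f (g b)))"
  have "is_cset C Y"
    unfolding Y_def using assms(2)
    by (intro is_cset_mk_cset) (auto simp: finite_pts act_in act_Id act_Comp g g_act)
  moreover have "iso_cset C X Y"
    unfolding Y_def using assms(1,2)
    by (intro iso_csetI[where \<eta> = "\<lambda>x. h" and \<theta> = "\<lambda>x. g"]) (auto simp: g g_act Dom_in)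
  ultimately show ?thesis by blast
qed

text \<open>Finitely many objects with finite values have finitely many points in all, so the points
  can be numbered. Hence \<open>iso_class C X\<close> is nonempty whatever type \<open>X\<close>
  lives over.\<close>

lemma (in finite_category) ex_nat_copy:
  assumes "is_cset C X"
  shows "\<exists>Y :: ('a, 'b, nat) cset. is_cset C Y \<and> iso_cset C X Y"
proof -
  have "finite (\<Union>x \<in> Obj C. pts X x)"
    using finite_Obj assms by (auto simp: finite_pts)
  from finite_imp_inj_to_nat_seg[OF this]
  obtain h :: "_ \<Rightarrow> nat" where "inj_on h (\<Union>x \<in> Obj C. pts X x)"
    by metis
  then show ?thesis
    by (rule iso_cset_of_inj[OF category_axioms assms])
qed

section \<open>Recurrent points and the socle\<close>

text \<open>In the reachability preorder on the points of a \<open>C\<close>-set these are the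
  maximal points, like the recurrent states of a finite Markov chain.\<close>

definition recurrent :: "('o, 'm) category \<Rightarrow> ('o, 'm, 'a) cset \<Rightarrow> 'o \<Rightarrow> 'a \<Rightarrow> bool" where
  "recurrent C X x a \<longleftrightarrow> (\<forall>f \<in> Arr C. Dom C f = x \<longrightarrow>
     (\<exists>g \<in> Arr C. Dom C g = Cod C f \<and> Cod C g = x \<and> act X g (act X f a) = a))"

text \<open>By Yoneda a point of \<open>X\<close> at \<open>x\<close> is a transformation from the
  functor represented by \<open>x\<close>; this is its image, the least subset through that
  point.\<close>

definition orbit :: "('o, 'm) category \<Rightarrow> ('o, 'm, 'a) cset \<Rightarrow> 'o \<Rightarrow> 'a \<Rightarrow> ('o, 'm, 'a) cset" where
  "orbit C X x a =
     mk_cset C (\<lambda>y. {act X f a | f. f \<in> Arr C \<and> Dom C f = x \<and> Cod C f = y}) (act X)"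

text \<open>A pointwise condition instead of a decomposition, so that it can be transported along
  transformations and tested after restriction. \<open>semisimple_classes_eq\<close> identifies it
  with being a finite disjoint union of simples.\<close>

definition semisimple :: "('o, 'm) category \<Rightarrow> ('o, 'm, 'a) cset \<Rightarrow> bool" where
  "semisimple C X \<longleftrightarrow> is_cset C X \<and> (\<forall>x \<in> Obj C. \<forall>a \<in> pts X x. recurrent C X x a)"

text \<open>Collapses the unions over representatives that define the semiring operations, once the
  value is known not to depend on the representatives.\<close>

lemma UN_UN_const:
  assumes "x \<in> A" "y \<in> B" "\<And>a b. \<lbrakk>a \<in> A; b \<in> B\<rbrakk> \<Longrightarrow> f a b = f x y"
  shows "(\<Union>a \<in> A. \<Union>b \<in> B. f a b) = f x y"
proof -
  have "(\<Union>a \<in> A. \<Union>b \<in> B. f a b) = (\<Union>a \<in> A. \<Union>b \<in> B. f x y)"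
    by (intro SUP_cong refl assms(3))
  then show ?thesis
    using assms(1,2) by auto
qed

lemma csubsetD:
  assumes "csubset C Y X"
  shows csubset_is_cset: "is_cset C Y"
    and csubset_pts: "\<lbrakk>x \<in> Obj C; a \<in> pts Y x\<rbrakk> \<Longrightarrow> a \<in> pts X x"
    and csubset_act: "\<lbrakk>f \<in> Arr C; a \<in> pts Y (Dom C f)\<rbrakk> \<Longrightarrow> act Y f a = act X f a"
  using assms unfolding csubset_def by auto

lemma recurrentE:
  assumes "recurrent C X x a" "f \<in> Arr C" "Dom C f = x"
  obtains g where "g \<in> Arr C" "Dom C g = Cod C f" "Cod C g = x" "act X g (act X f a) = a"
  using assms unfolding recurrent_def by blast

context category
begin

text \<open>The arrow that returns \<open>a\<close> also returns its image, by naturality. It is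
  applied to isomorphisms, to inclusions into sums, and to the map to
  \<open>one_cset C\<close>.\<close>

lemma recurrent_nat_trans:
  assumes "is_cset C X" "nat_trans C X Y \<eta>" "a \<in> pts X x" "recurrent C X x a"
  shows "recurrent C Y x (\<eta> x a)"
  unfolding recurrent_def
proof (intro ballI impI)
  fix f assume f: "f \<in> Arr C" "Dom C f = x"
  obtain g where g: "g \<in> Arr C" "Dom C g = Cod C f" "Cod C g = x" "act X g (act X f a) = a"
    using recurrentE[OF assms(4) f] .
  have "act Y g (act Y f (\<eta> x a)) = \<eta> x (act X g (act X f a))"
    using nat_trans_act[OF assms(2) f(1), of a] nat_trans_act[OF assms(2) g(1), of "act X f a"]
      act_in[OF assms(1) f(1), of a] f g assms(3)
    by simp
  with g show "\<exists>g \<in> Arr C. Dom C g = Cod C f \<and> Cod C g = x \<and> act Y g (act Y f (\<eta> x a)) = \<eta> x a"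
    by auto
qed

lemma recurrent_csubset_iff:
  assumes "csubset C Y X" "a \<in> pts Y x"
  shows "recurrent C Y x a \<longleftrightarrow> recurrent C X x a"
proof -
  have "act Y g (act Y f a) = act X g (act X f a)"
    if "f \<in> Arr C" "g \<in> Arr C" "Dom C f = x" "Dom C g = Cod C f" for f g
    using that assms(2) csubset_act[OF assms(1)] act_in[OF csubset_is_cset[OF assms(1)], of f a] by simp
  then show ?thesis
    unfolding recurrent_def by (metis (no_types, lifting))
qed

lemma pts_orbit [simp]:
  "y \<in> Obj C \<Longrightarrow> pts (orbit C X x a) y = {act X f a | f. f \<in> Arr C \<and> Dom C f = x \<and> Cod C f = y}"
  by (simp add: orbit_def)

lemma csubset_orbit:
  assumes "is_cset C X" "a \<in> pts X x"
  shows "csubset C (orbit C X x a) X"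
  unfolding orbit_def
proof (rule csubset_mk_cset[OF assms(1)])
  fix g b assume g: "g \<in> Arr C" "b \<in> {act X f a | f. f \<in> Arr C \<and> Dom C f = x \<and> Cod C f = Dom C g}"
  then obtain f where f: "b = act X f a" "f \<in> Arr C" "Dom C f = x" "Cod C f = Dom C g"
    by blast
  have "act X g b = act X (Comp C g f) a"
    using act_Comp[OF assms(1) f(2) g(1) f(4)] assms(2) f by simp
  then show "act X g b \<in> {act X f a | f. f \<in> Arr C \<and> Dom C f = x \<and> Cod C f = Cod C g}"
    using f g(1) Comp_in[OF f(2) g(1) f(4)] Dom_Comp[OF f(2) g(1) f(4)] Cod_Comp[OF f(2) g(1) f(4)]
    by blast
qed (use assms act_in in auto)

lemma self_in_orbit:
  assumes "is_cset C X" "x \<in> Obj C" "a \<in> pts X x"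
  shows "a \<in> pts (orbit C X x a) x"
proof -
  have "a = act X (Id C x) a"
    using assms by (simp add: act_Id)
  then show ?thesis
    using assms(2) by (auto simp: Id_in Dom_Id Cod_Id intro!: exI[of _ "Id C x"])
qed

text \<open>The orbit of \<open>a\<close> is a nonempty subset of \<open>S\<close>, hence all of
  \<open>S\<close>.\<close>

lemma simple_cset_transitive:
  assumes "simple_cset C S" "x \<in> Obj C" "y \<in> Obj C" "a \<in> pts S x" "b \<in> pts S y"
  shows "\<exists>f \<in> Arr C. Dom C f = x \<and> Cod C f = y \<and> act S f a = b"
proof -
  have S: "is_cset C S"
    using assms(1) by (simp add: simple_cset_def)
  have "orbit C S x a \<noteq> empty_cset C"
    using self_in_orbit[OF S assms(2,4)] assms(2)
    by (metis csubset_is_cset csubset_orbit[OF S assms(4)] empty_iff eq_empty_cset_iff)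
  then have "orbit C S x a = S"
    using assms(1) csubset_orbit[OF S assms(4)] unfolding simple_cset_def by blast
  then have "b \<in> pts (orbit C S x a) y"
    using assms(5) by simp
  then show ?thesis
    using assms(3) by auto
qed

lemma simple_imp_semisimple:
  assumes "simple_cset C S"
  shows "semisimple C S"
proof -
  have S: "is_cset C S"
    using assms by (simp add: simple_cset_def)
  show ?thesis
    unfolding semisimple_def recurrent_def
    using simple_cset_transitive[OF assms Cod_in Dom_in] S by (auto simp: act_in)
qed

text \<open>A nonempty subset of the orbit contains some \<open>act X f a\<close>. Recurrence
  carries this point back to \<open>a\<close>, and with \<open>a\<close> the subset contains the
  whole orbit.\<close>

lemma simple_orbit:
  assumes X: "is_cset C X" and a: "x \<in> Obj C" "a \<in> pts X x" and rec: "recurrent C X x a"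
  shows "simple_cset C (orbit C X x a)"
  unfolding simple_cset_def
proof (intro conjI allI impI)
  let ?O = "orbit C X x a"
  have sub: "csubset C ?O X"
    using csubset_orbit[OF X a(2)] .
  show O: "is_cset C ?O"
    using csubset_is_cset[OF sub] .
  show "?O \<noteq> empty_cset C"
    using self_in_orbit[OF X a] a(1) eq_empty_cset_iff[OF O] by blast
  fix Y assume Y: "csubset C Y ?O"
  show "Y = ?O \<or> Y = empty_cset C"
  proof (rule disjCI)
    assume "Y \<noteq> empty_cset C"
    then obtain y b where b: "y \<in> Obj C" "b \<in> pts Y y"
      using eq_empty_cset_iff[OF csubset_is_cset[OF Y]] by blast
    then have "b \<in> pts ?O y"
      using csubset_pts[OF Y] by blast
    then obtain f where f: "b = act X f a" "f \<in> Arr C" "Dom C f = x" "Cod C f = y"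
      using b(1) by auto
    obtain g where g: "g \<in> Arr C" "Dom C g = y" "Cod C g = x" "act X g b = a"
      using recurrentE[OF rec f(2,3)] f by metis
    have act_Y: "act Y h c = act X h c" if "h \<in> Arr C" "c \<in> pts Y (Dom C h)" for h c
      using csubset_act[OF Y that] csubset_act[OF sub that(1)] csubset_pts[OF Y Dom_in[OF that(1)] that(2)]
      by simp
    have aY: "a \<in> pts Y x"
      using act_in[OF csubset_is_cset[OF Y] g(1)] act_Y[OF g(1)] b g by metis
    show "Y = ?O"
    proof (rule cset_eqI)
      fix z assume z: "z \<in> Obj C"
      have "act X h a \<in> pts Y z" if "h \<in> Arr C" "Dom C h = x" "Cod C h = z" for h
        using act_in[OF csubset_is_cset[OF Y] that(1)] act_Y[OF that(1)] that aY by metis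
      then show "pts Y z = pts ?O z"
        using csubset_pts[OF Y z] z by auto
    qed (use Y O csubset_is_cset csubset_act category_axioms in auto)
  qed
qed

text \<open>By transitivity any single point recovers the simple subset around it. So simple subsets
  with a common point coincide, and there are no more of them than points.\<close>

lemma simple_csubset_eq_orbit:
  assumes X: "is_cset C X" and S: "S \<in> simple_csubsets C X" and a: "x \<in> Obj C" "a \<in> pts S x"
  shows "S = orbit C X x a"
proof (rule cset_eqI)
  have sub: "csubset C S X" and simple: "simple_cset C S"
    using S by (auto simp: simple_csubsets_def)
  have aX: "a \<in> pts X x"
    using csubset_pts[OF sub a] .
  show S': "is_cset C S"
    using csubset_is_cset[OF sub] .
  show "is_cset C (orbit C X x a)"
    using csubset_is_cset[OF csubset_orbit[OF X aX]] .
  show pts: "pts S y = pts (orbit C X x a) y" if "y \<in> Obj C" for y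
  proof (intro subset_antisym subsetI)
    fix b assume "b \<in> pts S y"
    then show "b \<in> pts (orbit C X x a) y"
      using simple_cset_transitive[OF simple a(1) that a(2)] csubset_act[OF sub] a(2) that by fastforce
  next
    fix b assume "b \<in> pts (orbit C X x a) y"
    then show "b \<in> pts S y"
      using that act_in[OF S'] csubset_act[OF sub] a(2) by fastforce
  qed
  show "act S f b = act (orbit C X x a) f b" if "f \<in> Arr C" "b \<in> pts S (Dom C f)" for f b
    using that csubset_act[OF sub that] csubset_act[OF csubset_orbit[OF X aX] that(1)] pts[OF Dom_in[OF that(1)]]
    by simp
qed (rule category_axioms)

text \<open>Points of a simple subset are recurrent by transitivity; conversely a recurrent point
  lies in its own orbit, which is simple.\<close>

lemma pts_soc:
  assumes X: "is_cset C X" and x: "x \<in> Obj C"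
  shows "pts (soc C X) x = {a \<in> pts X x. recurrent C X x a}"
proof -
  have "recurrent C X x a \<and> a \<in> pts X x" if "S \<in> simple_csubsets C X" "a \<in> pts S x" for S a
  proof -
    have "csubset C S X" "semisimple C S"
      using that simple_imp_semisimple by (auto simp: simple_csubsets_def)
    then show ?thesis
      using that(2) x recurrent_csubset_iff csubset_pts unfolding semisimple_def by metis
  qed
  moreover have "\<exists>S \<in> simple_csubsets C X. a \<in> pts S x" if "recurrent C X x a" "a \<in> pts X x" for a
    using simple_orbit[OF X x that(2,1)] csubset_orbit[OF X that(2)] self_in_orbit[OF X x that(2)]
    unfolding simple_csubsets_def by blast
  ultimately show ?thesis
    using x by (auto simp: soc_def)
qed

lemma csubset_soc:
  assumes X: "is_cset C X"
  shows "csubset C (soc C X) X"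
proof -
  have eq: "pts (soc C X) x = (\<Union>S \<in> simple_csubsets C X. pts S x)" if "x \<in> Obj C" for x
    using that by (simp add: soc_def)
  show ?thesis
    unfolding soc_def
  proof (rule csubset_mk_cset[OF X])
    fix f a assume f: "f \<in> Arr C" "a \<in> (\<Union>S \<in> simple_csubsets C X. pts S (Dom C f))"
    then obtain S where S: "S \<in> simple_csubsets C X" "a \<in> pts S (Dom C f)"
      by blast
    then have "csubset C S X"
      by (simp add: simple_csubsets_def)
    then have "act X f a \<in> pts S (Cod C f)"
      using act_in[OF csubset_is_cset f(1) S(2)] csubset_act[OF _ f(1) S(2)] by metis
    then show "act X f a \<in> (\<Union>S \<in> simple_csubsets C X. pts S (Cod C f))"
      using S by blast
  qed (auto simp: simple_csubsets_def csubset_def)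
qed

lemma semisimple_soc: "is_cset C X \<Longrightarrow> semisimple C (soc C X)"
  using csubset_soc[of X] recurrent_csubset_iff[OF csubset_soc, of X]
  unfolding semisimple_def by (auto simp: csubset_is_cset) (auto simp: pts_soc)

text \<open>Both transformations preserve recurrence, so they restrict to the socles and remain
  inverse there.\<close>

lemma iso_cset_soc:
  assumes X: "is_cset C X" and Y: "is_cset C Y" and iso: "iso_cset C X Y"
  shows "iso_cset C (soc C X) (soc C Y)"
proof -
  obtain \<eta> \<theta> where 1: "nat_trans C X Y \<eta>" "nat_trans C Y X \<theta>"
    "\<And>x a. \<lbrakk>x \<in> Obj C; a \<in> pts X x\<rbrakk> \<Longrightarrow> \<theta> x (\<eta> x a) = a"
    "\<And>x b. \<lbrakk>x \<in> Obj C; b \<in> pts Y x\<rbrakk> \<Longrightarrow> \<eta> x (\<theta> x b) = b"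
    using iso_csetE[OF iso] by metis
  show ?thesis
  proof (rule iso_csetI)
    fix f a assume f: "f \<in> Arr C" and a: "a \<in> pts (soc C X) (Dom C f)"
    have aX: "a \<in> pts X (Dom C f)" "recurrent C X (Dom C f) a"
      using a f by (auto simp: pts_soc[OF X] Dom_in)
    have "\<eta> (Dom C f) a \<in> pts (soc C Y) (Dom C f)"
      using recurrent_nat_trans[OF X 1(1) aX] nat_trans_in[OF 1(1) Dom_in[OF f] aX(1)] f
      by (simp add: pts_soc[OF Y] Dom_in)
    then show "\<eta> (Cod C f) (act (soc C X) f a) = act (soc C Y) f (\<eta> (Dom C f) a)"
      using csubset_act[OF csubset_soc[OF X] f a] csubset_act[OF csubset_soc[OF Y] f] nat_trans_act[OF 1(1) f aX(1)]
      by simp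
  next
    show "\<eta> x a \<in> pts (soc C Y) x \<and> \<theta> x (\<eta> x a) = a" if "x \<in> Obj C" "a \<in> pts (soc C X) x" for x a
      using that recurrent_nat_trans[OF X 1(1)] by (simp add: pts_soc[OF X] pts_soc[OF Y] 1(3) nat_trans_in[OF 1(1)])
    show "\<theta> x b \<in> pts (soc C X) x \<and> \<eta> x (\<theta> x b) = b" if "x \<in> Obj C" "b \<in> pts (soc C Y) x" for x b
      using that recurrent_nat_trans[OF Y 1(2)] by (simp add: pts_soc[OF X] pts_soc[OF Y] 1(4) nat_trans_in[OF 1(2)])
  qed (use csubset_is_cset[OF csubset_soc[OF X]] category_axioms in auto)
qed

lemma semisimple_iso_cset:
  assumes X: "semisimple C X" and Y: "is_cset C Y" and iso: "iso_cset C X Y"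
  shows "semisimple C Y"
proof -
  obtain \<eta> \<theta> where 1: "nat_trans C X Y \<eta>" "nat_trans C Y X \<theta>"
    "\<And>x a. \<lbrakk>x \<in> Obj C; a \<in> pts X x\<rbrakk> \<Longrightarrow> \<theta> x (\<eta> x a) = a"
    "\<And>x b. \<lbrakk>x \<in> Obj C; b \<in> pts Y x\<rbrakk> \<Longrightarrow> \<eta> x (\<theta> x b) = b"
    using iso_csetE[OF iso] by metis
  have "recurrent C Y x b" if "x \<in> Obj C" "b \<in> pts Y x" for x b
  proof -
    have "\<theta> x b \<in> pts X x"
      using nat_trans_in[OF 1(2) that] .
    then show ?thesis
      using X recurrent_nat_trans[OF _ 1(1), of "\<theta> x b" x] 1(4)[OF that] that unfolding semisimple_def by auto
  qed
  with Y show ?thesis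
    by (simp add: semisimple_def)
qed

text \<open>Each point is the image of a recurrent one under a natural inclusion. For products no
  such argument exists, as the two coordinates may need different returning arrows; hence the socle
  in the product of classes.\<close>

lemma semisimple_sum:
  assumes X: "semisimple C X" and Y: "semisimple C Y"
  shows "semisimple C (sum_cset C X Y)"
proof -
  have c: "is_cset C X" "is_cset C Y"
    using X Y by (auto simp: semisimple_def)
  have nt: "nat_trans C X (sum_cset C X Y) (\<lambda>x. Inl)" "nat_trans C Y (sum_cset C X Y) (\<lambda>x. Inr)"
    by (auto intro!: nat_transI simp: Dom_in)
  have "recurrent C (sum_cset C X Y) x (Inl a)" if "x \<in> Obj C" "a \<in> pts X x" for x a
    using recurrent_nat_trans[OF c(1) nt(1)] X that unfolding semisimple_def by blast
  moreover have "recurrent C (sum_cset C X Y) x (Inr b)" if "x \<in> Obj C" "b \<in> pts Y x" for x b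
    using recurrent_nat_trans[OF c(2) nt(2)] Y that unfolding semisimple_def by blast
  ultimately show ?thesis
    using is_cset_sum[OF c] unfolding semisimple_def by auto
qed

lemma semisimple_disjoint_union:
  assumes "finite I" and "\<And>i. i \<in> I \<Longrightarrow> semisimple C (X i)"
  shows "semisimple C (disjoint_union_cset C I X)"
proof -
  have c: "is_cset C (X i)" if "i \<in> I" for i
    using assms that by (auto simp: semisimple_def)
  have "nat_trans C (X i) (disjoint_union_cset C I X) (\<lambda>x a. (i, a))" if "i \<in> I" for i
    using that by (auto intro!: nat_transI simp: Dom_in)
  then have "recurrent C (disjoint_union_cset C I X) x (i, a)" if "i \<in> I" "x \<in> Obj C" "a \<in> pts (X i) x" for x i a
    using that assms(2)[OF that(1)] recurrent_nat_trans[OF c[OF that(1)]] unfolding semisimple_def by blast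
  then show ?thesis
    using is_cset_disjoint_union[OF assms(1) c] unfolding semisimple_def by auto
qed

end

section \<open>Decomposition into simples and the semiring of semisimple classes\<close>

context finite_category
begin

lemma finite_simple_csubsets:
  assumes X: "is_cset C X"
  shows "finite (simple_csubsets C X)"
proof (rule finite_subset)
  show "simple_csubsets C X \<subseteq> (\<lambda>(x, a). orbit C X x a) ` (SIGMA x:Obj C. pts X x)"
  proof
    fix S assume S: "S \<in> simple_csubsets C X"
    then have sub: "csubset C S X" and "S \<noteq> empty_cset C"
      by (auto simp: simple_csubsets_def simple_cset_def)
    then obtain x a where "x \<in> Obj C" "a \<in> pts S x"
      using eq_empty_cset_iff[OF csubset_is_cset] by blast
    then show "S \<in> (\<lambda>(x, a). orbit C X x a) ` (SIGMA x:Obj C. pts X x)"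
      using simple_csubset_eq_orbit[OF X S] csubset_pts[OF sub] by force
  qed
  show "finite ((\<lambda>(x, a). orbit C X x a) ` (SIGMA x:Obj C. pts X x))"
    using X finite_Obj by (auto intro!: finite_imageI finite_SigmaI finite_pts)
qed

text \<open>Each point lies in a simple subset, because it is recurrent, and in only one, because
  that subset is its orbit. The index of this subset inverts the projection from the disjoint
  union.\<close>

lemma semisimple_decomposition:
  fixes X :: "('a, 'b, 'c) cset"
  assumes "semisimple C X"
  shows "\<exists>(n :: nat) S. (\<forall>i < n. S i \<in> simple_csubsets C X) \<and> iso_cset C X (disjoint_union_cset C {..<n} S)"
proof -
  have X: "is_cset C X"
    using assms by (simp add: semisimple_def)
  obtain S where bij: "bij_betw S {..<card (simple_csubsets C X)} (simple_csubsets C X)"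
    using ex_bij_betw_nat_finite[OF finite_simple_csubsets[OF X]] by (auto simp: lessThan_atLeast0)
  define n where "n = card (simple_csubsets C X)"
  have S: "S i \<in> simple_csubsets C X" if "i < n" for i
    using bij that by (auto simp: bij_betw_def n_def)
  then have sub: "csubset C (S i) X" if "i < n" for i
    using that by (simp add: simple_csubsets_def)
  have uniq: "i = j" if "i < n" "j < n" "x \<in> Obj C" "a \<in> pts (S i) x" "a \<in> pts (S j) x" for i j x a
  proof -
    have "S i = S j"
      using that simple_csubset_eq_orbit[OF X S] by metis
    then show ?thesis
      using that bij by (auto simp: bij_betw_def n_def inj_on_def)
  qed
  \<comment> \<open>The choice is forced wherever \<open>a\<close> is a point of \<open>X\<close> at
    \<open>x\<close>, and arbitrary elsewhere.\<close>
  define idx where "idx x a = (SOME i. i < n \<and> a \<in> pts (S i) x)" for x a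
  have ex: "\<exists>i < n. a \<in> pts (S i) x" if a: "x \<in> Obj C" "a \<in> pts X x" for x a
  proof -
    have "a \<in> pts (soc C X) x"
      using a assms by (simp add: pts_soc[OF X] semisimple_def)
    then obtain T where "T \<in> simple_csubsets C X" "a \<in> pts T x"
      using a(1) by (auto simp: soc_def)
    then show ?thesis
      using bij unfolding bij_betw_def n_def by (metis imageE lessThan_iff)
  qed
  then have idx: "idx x a < n \<and> a \<in> pts (S (idx x a)) x" if "x \<in> Obj C" "a \<in> pts X x" for x a
    unfolding idx_def by (rule someI_ex) (use that in auto)
  have idx_eq: "idx x a = i" if "x \<in> Obj C" "i < n" "a \<in> pts (S i) x" for x a i
    using uniq[OF _ that(2,1) _ that(3)] idx[OF that(1) csubset_pts[OF sub[OF that(2)] that(1,3)]] by blast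
  have "iso_cset C (disjoint_union_cset C {..<n} S) X"
  proof (rule iso_csetI[where \<eta> = "\<lambda>x. snd" and \<theta> = "\<lambda>x a. (idx x a, a)"])
    show "is_cset C (disjoint_union_cset C {..<n} S)"
      using sub by (intro is_cset_disjoint_union) (auto intro: csubset_is_cset)
  qed (auto simp: idx idx_eq csubset_act[OF sub] Dom_in category_axioms intro: csubset_pts[OF sub])
  then show ?thesis
    using S iso_cset_sym by blast
qed

text \<open>The disjoint unions on the left have their points in \<open>nat \<times> nat\<close>,
  hence the copy over \<open>nat\<close>; the other inclusion is the decomposition into
  simples.\<close>

lemma semisimple_classes_eq:
  "semisimple_classes C = {iso_class C X | X :: ('a, 'b, nat) cset. semisimple C X}"
proof (intro subset_antisym subsetI)
  fix A assume "A \<in> semisimple_classes C"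
  then obtain n :: nat and S :: "nat \<Rightarrow> ('a, 'b, nat) cset"
    where A: "A = iso_class C (disjoint_union_cset C {..<n} S)" and S: "\<forall>i < n. simple_cset C (S i)"
    unfolding semisimple_classes_def by blast
  have ss: "semisimple C (disjoint_union_cset C {..<n} S)"
    using S by (intro semisimple_disjoint_union) (auto intro: simple_imp_semisimple)
  then have "is_cset C (disjoint_union_cset C {..<n} S)"
    by (simp add: semisimple_def)
  then obtain Y :: "('a, 'b, nat) cset" where Y: "is_cset C Y" "iso_cset C (disjoint_union_cset C {..<n} S) Y"
    using ex_nat_copy by metis
  then show "A \<in> {iso_class C X | X :: ('a, 'b, nat) cset. semisimple C X}"
    using semisimple_iso_cset[OF ss Y] iso_class_cong[OF category_axioms Y(2)] A by blast
next
  fix A assume "A \<in> {iso_class C X | X :: ('a, 'b, nat) cset. semisimple C X}"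
  then obtain X :: "('a, 'b, nat) cset" where X: "A = iso_class C X" "semisimple C X"
    by blast
  obtain n :: nat and S where S: "\<forall>i < n. S i \<in> simple_csubsets C X" "iso_cset C X (disjoint_union_cset C {..<n} S)"
    using semisimple_decomposition[OF X(2)] by blast
  then show "A \<in> semisimple_classes C"
    using iso_class_cong[OF category_axioms S(2)] X(1)
    unfolding semisimple_classes_def simple_csubsets_def by blast
qed

text \<open>By a copy over \<open>nat\<close>, membership extends to \<open>C\<close>-sets over any
  type, such as sums, socles of products and the socle of \<open>one_cset C\<close>.\<close>

lemma iso_class_in_semisimple_classes:
  assumes "semisimple C X"
  shows "iso_class C X \<in> semisimple_classes C"
proof -
  obtain Y :: "('a, 'b, nat) cset" where Y: "is_cset C Y" "iso_cset C X Y"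
    using ex_nat_copy assms unfolding semisimple_def by metis
  then show ?thesis
    using semisimple_iso_cset[OF assms Y] iso_class_cong[OF category_axioms Y(2)]
    unfolding semisimple_classes_eq by auto
qed

lemma
  fixes X Y :: "('a, 'b, nat) cset"
  assumes X: "is_cset C X" and Y: "is_cset C Y"
  shows mult_iso_class: "iso_class C X \<otimes>\<^bsub>semisimple_semiring C\<^esub> iso_class C Y = iso_class C (soc C (prod_cset C X Y))"
    and add_iso_class: "iso_class C X \<oplus>\<^bsub>semisimple_semiring C\<^esub> iso_class C Y = iso_class C (sum_cset C X Y)"
proof -
  have 1: "iso_class C (soc C (prod_cset C X' Y')) = iso_class C (soc C (prod_cset C X Y))"
      "iso_class C (sum_cset C X' Y') = iso_class C (sum_cset C X Y)"
    if "X' \<in> iso_class C X" "Y' \<in> iso_class C Y" for X' Y'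
  proof -
    have XY: "is_cset C X'" "is_cset C Y'" "iso_cset C X X'" "iso_cset C Y Y'"
      using that by (auto simp: iso_class_def)
    show "iso_class C (soc C (prod_cset C X' Y')) = iso_class C (soc C (prod_cset C X Y))"
      by (intro iso_class_cong[symmetric] iso_cset_soc iso_cset_prod is_cset_prod category_axioms X Y XY)
    show "iso_class C (sum_cset C X' Y') = iso_class C (sum_cset C X Y)"
      by (intro iso_class_cong[symmetric] iso_cset_sum category_axioms X Y XY)
  qed
  have 2: "X \<in> iso_class C X" "Y \<in> iso_class C Y"
    using X Y by (auto simp: self_in_iso_class)
  show "iso_class C X \<otimes>\<^bsub>semisimple_semiring C\<^esub> iso_class C Y = iso_class C (soc C (prod_cset C X Y))"
    using UN_UN_const[of X _ Y _ "\<lambda>X' Y'. iso_class C (soc C (prod_cset C X' Y'))", OF 2 1(1)]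
    by (simp add: semisimple_semiring_def)
  show "iso_class C X \<oplus>\<^bsub>semisimple_semiring C\<^esub> iso_class C Y = iso_class C (sum_cset C X Y)"
    using UN_UN_const[of X _ Y _ "\<lambda>X' Y'. iso_class C (sum_cset C X' Y')", OF 2 1(2)]
    by (simp add: semisimple_semiring_def)
qed

end

section \<open>Restriction to a full subcategory closed under outgoing morphisms\<close>

lemma full_subcategory_simps [simp]:
  "Obj (full_subcategory C A) = Obj C \<inter> A"
  "f \<in> Arr (full_subcategory C A) \<longleftrightarrow> f \<in> Arr C \<and> Dom C f \<in> A \<and> Cod C f \<in> A"
  "Dom (full_subcategory C A) = Dom C"
  "Cod (full_subcategory C A) = Cod C"
  "Id (full_subcategory C A) = Id C"
  "Comp (full_subcategory C A) = Comp C"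
  by (simp_all add: full_subcategory_def)

lemma (in category) category_full_subcategory: "category (full_subcategory C A)"
  by (rule category.intro)
    (simp_all add: Dom_in Cod_in Id_in Dom_Id Cod_Id Comp_in Dom_Comp Cod_Comp Comp_Id Id_Comp Comp_assoc)

lemma (in finite_category) finite_category_full_subcategory: "finite_category (full_subcategory C A)"
proof -
  have "Arr (full_subcategory C A) \<subseteq> Arr C"
    by auto
  then show ?thesis
    using category_full_subcategory finite_Obj finite_Arr
    by (auto simp: finite_category_def finite_category_axioms_def intro: finite_subset)
qed

definition restr :: "('o, 'm) category \<Rightarrow> 'o set \<Rightarrow> ('o, 'm, 'a) cset \<Rightarrow> ('o, 'm, 'a) cset" where
  "restr C A X = mk_cset (full_subcategory C A) (pts X) (act X)"

definition restr_class :: "('o, 'm) category \<Rightarrow> 'o set \<Rightarrow> ('o, 'm) cset_class \<Rightarrow> ('o, 'm) cset_class" where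
  "restr_class C A P = (\<Union>X \<in> P. iso_class (full_subcategory C A) (restr C A X))"

lemma pts_restr [simp]: "\<lbrakk>x \<in> Obj C; x \<in> A\<rbrakk> \<Longrightarrow> pts (restr C A X) x = pts X x"
  by (simp add: restr_def)

lemma act_restr [simp]:
  "\<lbrakk>f \<in> Arr C; Dom C f \<in> A; Cod C f \<in> A; a \<in> pts X (Dom C f)\<rbrakk> \<Longrightarrow> act (restr C A X) f a = act X f a"
  by (simp add: restr_def)

context category
begin

lemma is_cset_restr: "is_cset C X \<Longrightarrow> is_cset (full_subcategory C A) (restr C A X)"
  unfolding restr_def
  by (rule category.is_cset_mk_cset[OF category_full_subcategory])
    (auto simp: finite_pts act_in act_Id act_Comp)

text \<open>Equality and not just isomorphism, since both sides have the default values off the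
  subcategory. Restriction thus commutes strictly with the constructions on \<open>C\<close>-sets,
  and no comparison isomorphisms have to be carried along.\<close>

lemma restr_eqI:
  assumes "is_cset C X" "is_cset (full_subcategory C A) Y"
    and "\<And>x. \<lbrakk>x \<in> Obj C; x \<in> A\<rbrakk> \<Longrightarrow> pts X x = pts Y x"
    and "\<And>f a. \<lbrakk>f \<in> Arr C; Dom C f \<in> A; Cod C f \<in> A; a \<in> pts Y (Dom C f)\<rbrakk> \<Longrightarrow> act X f a = act Y f a"
  shows "restr C A X = Y"
  by (rule cset_eqI[OF is_cset_restr[OF assms(1)] assms(2) _ _ category_full_subcategory])
    (simp_all add: assms Dom_in)

lemma restr_empty: "restr C A (empty_cset C) = empty_cset (full_subcategory C A)"
  by (rule restr_eqI[OF is_cset_empty category.is_cset_empty[OF category_full_subcategory]])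
    (simp_all add: empty_cset_def Dom_in)

lemma restr_one: "restr C A (one_cset C) = one_cset (full_subcategory C A)"
  by (rule restr_eqI[OF is_cset_one category.is_cset_one[OF category_full_subcategory]])
    (simp_all add: one_cset_def Dom_in)

lemma restr_prod:
  assumes "is_cset C X" "is_cset C Y"
  shows "restr C A (prod_cset C X Y) = prod_cset (full_subcategory C A) (restr C A X) (restr C A Y)"
  by (rule restr_eqI[OF is_cset_prod[OF assms]
        category.is_cset_prod[OF category_full_subcategory is_cset_restr is_cset_restr, OF assms]])
    (auto simp: Dom_in)

lemma restr_sum:
  assumes "is_cset C X" "is_cset C Y"
  shows "restr C A (sum_cset C X Y) = sum_cset (full_subcategory C A) (restr C A X) (restr C A Y)"
  by (rule restr_eqI[OF is_cset_sum[OF assms]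
        category.is_cset_sum[OF category_full_subcategory is_cset_restr is_cset_restr, OF assms]])
    (auto simp: Dom_in)

lemma iso_cset_restr:
  assumes "iso_cset C X Y"
  shows "iso_cset (full_subcategory C A) (restr C A X) (restr C A Y)"
proof -
  obtain \<eta> \<theta> where 1: "nat_trans C X Y \<eta>" "nat_trans C Y X \<theta>"
    "\<And>x a. \<lbrakk>x \<in> Obj C; a \<in> pts X x\<rbrakk> \<Longrightarrow> \<theta> x (\<eta> x a) = a"
    "\<And>x b. \<lbrakk>x \<in> Obj C; b \<in> pts Y x\<rbrakk> \<Longrightarrow> \<eta> x (\<theta> x b) = b"
    using iso_csetE[OF assms] by metis
  have "nat_trans (full_subcategory C A) (restr C A Z) (restr C A Z') \<zeta>" if "nat_trans C Z Z' \<zeta>" for Z Z' \<zeta>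
    by (rule nat_transI) (simp_all add: nat_trans_in[OF that] nat_trans_act[OF that] Dom_in)
  from this[OF 1(1)] this[OF 1(2)] show ?thesis
    unfolding iso_cset_def by (intro exI[of _ \<eta>] exI[of _ \<theta>]) (simp add: 1(3,4))
qed

end

context finite_category
begin

text \<open>All classes in the union agree, but the union is a class only if it is not empty; the
  copy over \<open>nat\<close> provides a member.\<close>

lemma restr_class_iso_class:
  assumes "is_cset C X"
  shows "restr_class C A (iso_class C X) = iso_class (full_subcategory C A) (restr C A X)"
proof -
  have "iso_class (full_subcategory C A) (restr C A Y) = iso_class (full_subcategory C A) (restr C A X)"
    if "Y \<in> iso_class C X" for Y
    using that iso_class_cong[OF category_full_subcategory iso_cset_restr] by (fastforce simp: iso_class_def[of C])
  moreover have "iso_class C X \<noteq> {}"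
    using ex_nat_copy[OF assms] by (auto simp: iso_class_def)
  ultimately show ?thesis
    unfolding restr_class_def by simp
qed

end

text \<open>No arrow leaves \<open>A\<close>, that is, \<open>A\<close> is a cosieve. Otherwise a
  point could be recurrent over \<open>D\<close> and yet be moved out of \<open>A\<close> by an
  arrow of \<open>C\<close> with no way back.\<close>

locale closed_full_subcategory = finite_category C
  for C :: "('o, 'm) category" and A :: "'o set" +
  assumes closed: "\<lbrakk>f \<in> Arr C; Dom C f \<in> A\<rbrakk> \<Longrightarrow> Cod C f \<in> A"
begin

abbreviation "D \<equiv> full_subcategory C A"

sublocale sub: finite_category D
  by (rule finite_category_full_subcategory)

text \<open>All arrows of \<open>C\<close> out of \<open>x\<close> belong to \<open>D\<close>, and
  an arrow returning to \<open>x\<close> starts where such an arrow ended, so it lies in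
  \<open>D\<close> as well.\<close>

lemma recurrent_restr_iff:
  assumes X: "is_cset C X" and a: "x \<in> A" "a \<in> pts X x"
  shows "recurrent D (restr C A X) x a \<longleftrightarrow> recurrent C X x a"
proof -
  have eq: "act (restr C A X) g (act (restr C A X) f a) = act X g (act X f a)"
    if "f \<in> Arr C" "Dom C f = x" "g \<in> Arr C" "Dom C g = Cod C f" for f g
    using that a closed[of f] closed[of g] act_in[OF X, of f a] by simp
  have arr: "f \<in> Arr D \<longleftrightarrow> f \<in> Arr C \<and> Dom C f \<in> A" for f
    using closed[of f] by auto
  have "(\<exists>g \<in> Arr D. Dom D g = Cod D f \<and> Cod D g = x \<and> act (restr C A X) g (act (restr C A X) f a) = a) \<longleftrightarrow>
      (\<exists>g \<in> Arr C. Dom C g = Cod C f \<and> Cod C g = x \<and> act X g (act X f a) = a)"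
    if "f \<in> Arr C" "Dom C f = x" for f
    using closed[of f] that a(1) eq[OF that] unfolding Bex_def arr full_subcategory_simps(3,4) by metis
  then show ?thesis
    using a(1) unfolding recurrent_def Ball_def arr full_subcategory_simps(3) by (auto 0 0)
qed

lemma restr_soc:
  assumes X: "is_cset C X"
  shows "restr C A (soc C X) = soc D (restr C A X)"
proof (rule restr_eqI)
  have X': "is_cset D (restr C A X)"
    using is_cset_restr[OF X] .
  show "is_cset C (soc C X)" "is_cset D (soc D (restr C A X))"
    using csubset_is_cset[OF csubset_soc[OF X]] csubset_is_cset[OF sub.csubset_soc[OF X']] .
  show pts: "pts (soc C X) x = pts (soc D (restr C A X)) x" if "x \<in> Obj C" "x \<in> A" for x
    using that by (auto simp: pts_soc[OF X] sub.pts_soc[OF X'] recurrent_restr_iff[OF X])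
  fix f a assume f: "f \<in> Arr C" "Dom C f \<in> A" "Cod C f \<in> A" and a: "a \<in> pts (soc D (restr C A X)) (Dom C f)"
  have a': "a \<in> pts (soc C X) (Dom C f)" "a \<in> pts X (Dom C f)"
    using a pts[OF Dom_in] f csubset_pts[OF csubset_soc[OF X] Dom_in] by auto
  show "act (soc C X) f a = act (soc D (restr C A X)) f a"
    using csubset_act[OF csubset_soc[OF X] f(1) a'(1)] csubset_act[OF sub.csubset_soc[OF X'], of f a] f a a'
    by simp
qed

lemma semisimple_restr:
  assumes "semisimple C X"
  shows "semisimple D (restr C A X)"
  using assms is_cset_restr[of X] recurrent_restr_iff[of X] unfolding semisimple_def by auto

lemma restr_class_hom: "restr_class C A \<in> ring_hom (semisimple_semiring C) (semisimple_semiring D)"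
proof (rule ring_hom_memI)
  fix P assume "P \<in> carrier (semisimple_semiring C)"
  then obtain X :: "('o, 'm, nat) cset" where P: "P = iso_class C X" and X: "semisimple C X"
    by (auto simp: semisimple_semiring_def semisimple_classes_eq)
  have cX: "is_cset C X"
    using X by (simp add: semisimple_def)
  show "restr_class C A P \<in> carrier (semisimple_semiring D)"
    using sub.iso_class_in_semisimple_classes[OF semisimple_restr[OF X]]
    by (simp add: P restr_class_iso_class[OF cX] semisimple_semiring_def)
  fix Q assume "Q \<in> carrier (semisimple_semiring C)"
  then obtain Y :: "('o, 'm, nat) cset" where Q: "Q = iso_class C Y" and Y: "semisimple C Y"
    by (auto simp: semisimple_semiring_def semisimple_classes_eq)
  have cY: "is_cset C Y"
    using Y by (simp add: semisimple_def)
  note cXY = is_cset_prod[OF cX cY]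
  show "restr_class C A (P \<otimes>\<^bsub>semisimple_semiring C\<^esub> Q) =
      restr_class C A P \<otimes>\<^bsub>semisimple_semiring D\<^esub> restr_class C A Q"
    by (simp add: P Q mult_iso_class cX cY restr_class_iso_class csubset_is_cset[OF csubset_soc[OF cXY]]
        sub.mult_iso_class is_cset_restr restr_soc[OF cXY] restr_prod)
  show "restr_class C A (P \<oplus>\<^bsub>semisimple_semiring C\<^esub> Q) =
      restr_class C A P \<oplus>\<^bsub>semisimple_semiring D\<^esub> restr_class C A Q"
    by (simp add: P Q add_iso_class cX cY restr_class_iso_class is_cset_sum
        sub.add_iso_class is_cset_restr restr_sum)
next
  show "restr_class C A \<one>\<^bsub>semisimple_semiring C\<^esub> = \<one>\<^bsub>semisimple_semiring D\<^esub>"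
    by (simp add: semisimple_semiring_def restr_class_iso_class csubset_is_cset[OF csubset_soc[OF is_cset_one]]
        restr_soc[OF is_cset_one] restr_one)
qed

lemma restr_class_zero: "restr_class C A \<zero>\<^bsub>semisimple_semiring C\<^esub> = \<zero>\<^bsub>semisimple_semiring D\<^esub>"
  by (simp add: semisimple_semiring_def restr_class_iso_class is_cset_empty restr_empty)

end

section \<open>Gluing\<close>

text \<open>Only the recurrent objects have to be covered. Arrows may enter a piece from an object
  outside all pieces, but semisimple \<open>C\<close>-sets are empty at such an object.\<close>

locale recurrent_partition = finite_category C
  for C :: "('o, 'm) category" and I :: "'i set" and A :: "'i \<Rightarrow> 'o set" +
  assumes closed: "\<lbrakk>i \<in> I; f \<in> Arr C; Dom C f \<in> A i\<rbrakk> \<Longrightarrow> Cod C f \<in> A i"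
    and disjoint: "\<lbrakk>i \<in> I; j \<in> I; x \<in> A i; x \<in> A j\<rbrakk> \<Longrightarrow> i = j"
    and cover: "\<lbrakk>x \<in> Obj C; recurrent C (one_cset C) x ()\<rbrakk> \<Longrightarrow> \<exists>i \<in> I. x \<in> A i"
begin

lemma closed_full_subcategory: "i \<in> I \<Longrightarrow> closed_full_subcategory C (A i)"
  by unfold_locales (rule closed)

text \<open>A recurrent point over \<open>x\<close> is sent by the map to \<open>one_cset C\<close>
  to a recurrent point over \<open>x\<close>.\<close>

lemma supp_semisimple:
  assumes "semisimple C X" "x \<in> Obj C" "a \<in> pts X x"
  shows "\<exists>i \<in> I. x \<in> A i"
proof -
  have "nat_trans C X (one_cset C) (\<lambda>x a. ())"
    by (rule nat_transI) (auto simp: one_cset_def)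
  then have "recurrent C (one_cset C) x ()"
    using assms recurrent_nat_trans[of X "one_cset C" "\<lambda>x a. ()" a x] unfolding semisimple_def by blast
  then show ?thesis
    using cover assms(2) by blast
qed

text \<open>Arbitrary outside the union of the \<open>A i\<close>, where semisimple
  \<open>C\<close>-sets have no points.\<close>

definition component :: "'o \<Rightarrow> 'i" where
  "component x = (THE i. i \<in> I \<and> x \<in> A i)"

lemma component_eq: "\<lbrakk>i \<in> I; x \<in> A i\<rbrakk> \<Longrightarrow> component x = i"
  unfolding component_def using disjoint by blast

text \<open>No point lies outside the pieces and no arrow leads from one piece to another, so
  isomorphisms chosen independently on the pieces combine, and each naturality square stays inside
  one piece.\<close>

lemma iso_cset_if_restr:
  assumes X: "semisimple C X" and Y: "semisimple C Y"
    and iso: "\<And>i. i \<in> I \<Longrightarrow> iso_cset (full_subcategory C (A i)) (restr C (A i) X) (restr C (A i) Y)"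
  shows "iso_cset C X Y"
proof -
  let ?D = "\<lambda>i. full_subcategory C (A i)"
  \<comment> \<open>Pairing the two transformations lets a single application of choice select both
    for every \<open>i\<close>.\<close>
  have "\<forall>i. \<exists>p. i \<in> I \<longrightarrow> nat_trans (?D i) (restr C (A i) X) (restr C (A i) Y) (fst p) \<and>
      nat_trans (?D i) (restr C (A i) Y) (restr C (A i) X) (snd p) \<and>
      (\<forall>x \<in> Obj (?D i). (\<forall>a \<in> pts (restr C (A i) X) x. snd p x (fst p x a) = a) \<and>
        (\<forall>b \<in> pts (restr C (A i) Y) x. fst p x (snd p x b) = b))"
    using iso unfolding iso_cset_def by (metis fst_conv snd_conv)
  then obtain p where p: "\<forall>i. i \<in> I \<longrightarrow> nat_trans (?D i) (restr C (A i) X) (restr C (A i) Y) (fst (p i)) \<and>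
      nat_trans (?D i) (restr C (A i) Y) (restr C (A i) X) (snd (p i)) \<and>
      (\<forall>x \<in> Obj (?D i). (\<forall>a \<in> pts (restr C (A i) X) x. snd (p i) x (fst (p i) x a) = a) \<and>
        (\<forall>b \<in> pts (restr C (A i) Y) x. fst (p i) x (snd (p i) x b) = b))"
    by (rule choice[THEN exE])
  define \<eta> where "\<eta> i = fst (p i)" for i
  define \<theta> where "\<theta> i = snd (p i)" for i
  have nt: "nat_trans (?D i) (restr C (A i) X) (restr C (A i) Y) (\<eta> i)"
      "nat_trans (?D i) (restr C (A i) Y) (restr C (A i) X) (\<theta> i)" if "i \<in> I" for i
    using p that by (auto simp: \<eta>_def \<theta>_def)
  have inv: "a \<in> pts X x \<Longrightarrow> \<theta> i x (\<eta> i x a) = a" "b \<in> pts Y x \<Longrightarrow> \<eta> i x (\<theta> i x b) = b"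
    if "i \<in> I" "x \<in> Obj C" "x \<in> A i" for i x a b
    using p that by (auto simp: \<eta>_def \<theta>_def)
  show ?thesis
  proof (rule iso_csetI[where \<eta> = "\<lambda>x. \<eta> (component x) x" and \<theta> = "\<lambda>x. \<theta> (component x) x"])
    fix x a assume x: "x \<in> Obj C" and a: "a \<in> pts X x"
    obtain i where "i \<in> I" "x \<in> A i"
      using supp_semisimple[OF X x a] by blast
    then show "\<eta> (component x) x a \<in> pts Y x \<and> \<theta> (component x) x (\<eta> (component x) x a) = a"
      using nat_trans_in[OF nt(1), of i x a] inv(1)[of i x a] x a by (simp add: component_eq)
  next
    fix x b assume x: "x \<in> Obj C" and b: "b \<in> pts Y x"
    obtain i where "i \<in> I" "x \<in> A i"
      using supp_semisimple[OF Y x b] by blast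
    then show "\<theta> (component x) x b \<in> pts X x \<and> \<eta> (component x) x (\<theta> (component x) x b) = b"
      using nat_trans_in[OF nt(2), of i x b] inv(2)[of i x b] x b by (simp add: component_eq)
  next
    fix f a assume f: "f \<in> Arr C" and a: "a \<in> pts X (Dom C f)"
    obtain i where i: "i \<in> I" "Dom C f \<in> A i"
      using supp_semisimple[OF X Dom_in[OF f] a] by blast
    have c: "Cod C f \<in> A i"
      using closed i f by blast
    have "\<eta> i (Dom C f) a \<in> pts Y (Dom C f)"
      using nat_trans_in[OF nt(1)[OF i(1)], of "Dom C f" a] i f a by (simp add: Dom_in)
    then show "\<eta> (component (Cod C f)) (Cod C f) (act X f a) = act Y f (\<eta> (component (Dom C f)) (Dom C f) a)"
      using nat_trans_act[OF nt(1)[OF i(1)], of f a] i f a c by (simp add: component_eq Dom_in)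
  qed (use X category_axioms in \<open>auto simp: semisimple_def\<close>)
qed

text \<open>The family is extended by the empty set. An arrow starting in a piece stays in it, and
  an arrow starting outside all pieces acts on no points, so every functor law is inherited from a
  single piece.\<close>

lemma ex_glued_cset:
  fixes X :: "'i \<Rightarrow> ('o, 'm, 'a) cset"
  assumes X: "\<And>i. i \<in> I \<Longrightarrow> semisimple (full_subcategory C (A i)) (X i)"
  shows "\<exists>Y. semisimple C Y \<and> (\<forall>i \<in> I. restr C (A i) Y = X i)"
proof -
  let ?D = "\<lambda>i. full_subcategory C (A i)"
  have cX: "is_cset (?D i) (X i)" if "i \<in> I" for i
    using X[OF that] by (simp add: semisimple_def)
  define B where "B x = (if \<exists>i \<in> I. x \<in> A i then pts (X (component x)) x else {})" for x
  define Y where "Y = mk_cset C B (\<lambda>f. act (X (component (Dom C f))) f)"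
  have B: "B x = pts (X i) x" if "i \<in> I" "x \<in> A i" for i x
    using that component_eq[OF that] by (auto simp: B_def)
  have B_E: "\<exists>i. i \<in> I \<and> x \<in> A i \<and> a \<in> pts (X i) x" if "a \<in> B x" for x a
    using that component_eq by (auto simp: B_def split: if_splits)
  have cY: "is_cset C Y"
    unfolding Y_def
  proof (rule is_cset_mk_cset)
    fix x assume x: "x \<in> Obj C"
    show "finite (B x)"
    proof (cases "\<exists>i \<in> I. x \<in> A i")
      case True
      then show ?thesis
        using finite_pts[OF cX] x B by auto
    qed (simp add: B_def)
  next
    fix f a assume f: "f \<in> Arr C" "a \<in> B (Dom C f)"
    obtain i where i: "i \<in> I" "Dom C f \<in> A i" "a \<in> pts (X i) (Dom C f)"
      using B_E[OF f(2)] by blast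
    then show "act (X (component (Dom C f))) f a \<in> B (Cod C f)"
      using f closed[OF i(1) f(1) i(2)] act_in[OF cX[OF i(1)], of f a] by (simp add: component_eq B)
  next
    fix x a assume x: "x \<in> Obj C" "a \<in> B x"
    obtain i where i: "i \<in> I" "x \<in> A i" "a \<in> pts (X i) x"
      using B_E[OF x(2)] by blast
    then show "act (X (component (Dom C (Id C x)))) (Id C x) a = a"
      using x act_Id[OF cX[OF i(1)], of x a] by (simp add: component_eq Dom_Id)
  next
    fix f g a assume f: "f \<in> Arr C" "g \<in> Arr C" "Cod C f = Dom C g" "a \<in> B (Dom C f)"
    obtain i where i: "i \<in> I" "Dom C f \<in> A i" "a \<in> pts (X i) (Dom C f)"
      using B_E[OF f(4)] by blast
    then show "act (X (component (Dom C (Comp C g f)))) (Comp C g f) a =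
        act (X (component (Dom C g))) g (act (X (component (Dom C f))) f a)"
      using f closed[OF i(1) f(1) i(2)] closed[OF i(1) f(2)] act_Comp[OF cX[OF i(1)], of f g a]
      by (simp add: component_eq Dom_Comp)
  qed
  have restr_Y: "restr C (A i) Y = X i" if i: "i \<in> I" for i
    by (rule restr_eqI[OF cY cX[OF i]]) (simp_all add: Y_def B[OF i] component_eq[OF i])
  have "recurrent C Y x a" if x: "x \<in> Obj C" "a \<in> pts Y x" for x a
  proof -
    obtain i where i: "i \<in> I" "x \<in> A i" "a \<in> pts (X i) x"
      using B_E[of a x] x by (auto simp: Y_def)
    have "recurrent (?D i) (restr C (A i) Y) x a"
      using X[OF i(1)] i x by (simp add: restr_Y semisimple_def)
    then show ?thesis
      using closed_full_subcategory.recurrent_restr_iff[OF closed_full_subcategory[OF i(1)] cY i(2) x(2)] by simp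
  qed
  with cY restr_Y show ?thesis
    unfolding semisimple_def by blast
qed

text \<open>The restrictions to the pieces are jointly injective by combining isomorphisms and
  jointly surjective by gluing. The list only fixes an order of the factors.\<close>

theorem simple_burnside_ring_iso_RDirProd_list:
  assumes "distinct is" "set is = I"
  shows "simple_burnside_ring C \<simeq>
    RDirProd_list (map (\<lambda>i. simple_burnside_ring (full_subcategory C (A i))) is)"
  unfolding simple_burnside_ring_def
proof (rule grothendieck_ring_iso_RDirProd_list[where \<phi> = "\<lambda>i. restr_class C (A i)"])
  let ?R = "semisimple_semiring C"
  have carrier: "P \<in> carrier ?R \<longleftrightarrow> (\<exists>X :: ('o, 'm, nat) cset. P = iso_class C X \<and> semisimple C X)" for P
    by (auto simp: semisimple_semiring_def semisimple_classes_eq)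
  have "semisimple C (empty_cset C :: ('o, 'm, nat) cset)"
    using is_cset_empty eq_empty_cset_iff[OF is_cset_empty] unfolding semisimple_def by auto
  then show "\<zero>\<^bsub>?R\<^esub> \<in> carrier ?R"
    by (simp add: semisimple_semiring_def iso_class_in_semisimple_classes)
  show "\<one>\<^bsub>?R\<^esub> \<in> carrier ?R"
    by (simp add: semisimple_semiring_def iso_class_in_semisimple_classes semisimple_soc is_cset_one)
  show "P \<oplus>\<^bsub>?R\<^esub> Q \<in> carrier ?R" "P \<otimes>\<^bsub>?R\<^esub> Q \<in> carrier ?R"
    if PQ: "P \<in> carrier ?R" "Q \<in> carrier ?R" for P Q
  proof -
    obtain X Y :: "('o, 'm, nat) cset"
      where XY: "P = iso_class C X" "semisimple C X" "Q = iso_class C Y" "semisimple C Y"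
      using PQ unfolding carrier by blast
    have c: "is_cset C X" "is_cset C Y"
      using XY(2,4) by (simp_all add: semisimple_def)
    have "iso_class C (sum_cset C X Y) \<in> semisimple_classes C"
      using iso_class_in_semisimple_classes[OF semisimple_sum[OF XY(2,4)]] .
    then show "P \<oplus>\<^bsub>?R\<^esub> Q \<in> carrier ?R"
      unfolding XY add_iso_class[OF c] by (simp add: semisimple_semiring_def)
    have "iso_class C (soc C (prod_cset C X Y)) \<in> semisimple_classes C"
      using iso_class_in_semisimple_classes[OF semisimple_soc[OF is_cset_prod[OF c]]] .
    then show "P \<otimes>\<^bsub>?R\<^esub> Q \<in> carrier ?R"
      unfolding XY mult_iso_class[OF c] by (simp add: semisimple_semiring_def)
  qed
  show "restr_class C (A i) \<in> ring_hom ?R (semisimple_semiring (full_subcategory C (A i)))"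
      "restr_class C (A i) \<zero>\<^bsub>?R\<^esub> = \<zero>\<^bsub>semisimple_semiring (full_subcategory C (A i))\<^esub>"
    if "i \<in> set is" for i
    using that assms(2) closed_full_subcategory.restr_class_hom[OF closed_full_subcategory]
      closed_full_subcategory.restr_class_zero[OF closed_full_subcategory] by auto
  show "P = Q" if PQ: "P \<in> carrier ?R" "Q \<in> carrier ?R"
    and eq: "\<And>i. i \<in> set is \<Longrightarrow> restr_class C (A i) P = restr_class C (A i) Q" for P Q
  proof -
    obtain X Y :: "('o, 'm, nat) cset"
      where XY: "P = iso_class C X" "semisimple C X" "Q = iso_class C Y" "semisimple C Y"
      using PQ unfolding carrier by blast
    have c: "is_cset C X" "is_cset C Y"
      using XY(2,4) by (simp_all add: semisimple_def)
    have "iso_cset (full_subcategory C (A i)) (restr C (A i) X) (restr C (A i) Y)" if "i \<in> I" for i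
      using eq[of i] that assms(2)
      by (intro iso_class_eqD is_cset_restr c) (simp add: XY restr_class_iso_class c)
    then show ?thesis
      using iso_class_cong[OF category_axioms iso_cset_if_restr[OF XY(2,4)]] XY by simp
  qed
  show "\<exists>P \<in> carrier ?R. \<forall>i \<in> set is. restr_class C (A i) P = r i"
    if r: "\<And>i. i \<in> set is \<Longrightarrow> r i \<in> carrier (semisimple_semiring (full_subcategory C (A i)))" for r
  proof -
    have "\<forall>i. \<exists>X :: ('o, 'm, nat) cset. i \<in> I \<longrightarrow>
        r i = iso_class (full_subcategory C (A i)) X \<and> semisimple (full_subcategory C (A i)) X"
      using r assms(2) finite_category.semisimple_classes_eq[OF finite_category_full_subcategory]
      by (auto simp: semisimple_semiring_def)
    then obtain X :: "'i \<Rightarrow> ('o, 'm, nat) cset" where X: "\<forall>i. i \<in> I \<longrightarrow>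
        r i = iso_class (full_subcategory C (A i)) (X i) \<and> semisimple (full_subcategory C (A i)) (X i)"
      by (rule choice[THEN exE])
    obtain Y where Y: "semisimple C Y" "\<forall>i \<in> I. restr C (A i) Y = X i"
      using ex_glued_cset[of X] X by blast
    then have "restr_class C (A i) (iso_class C Y) = r i" if "i \<in> I" for i
      using X that by (simp add: restr_class_iso_class semisimple_def)
    moreover have "iso_class C Y \<in> carrier ?R"
      using Y(1) carrier by blast
    ultimately show ?thesis
      using assms(2) by blast
  qed
qed (rule assms(1))

end

section \<open>The supports of the simple subsets of the socle as a recurrent partition\<close>

theorem theorem6p6:
  fixes C :: "('o, 'm) category"
    and n :: nat
    and S :: "nat \<Rightarrow> ('o, 'm, unit) cset"
  assumes "finite_category C"
    and "connected_category C"
    and "bij_betw S {1..n} (simple_csubsets C (soc C (one_cset C)))"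
  shows "simple_burnside_ring C \<simeq>
    RDirProd_list
      (map (\<lambda>i. simple_burnside_ring (full_subcategory C (supp C (S i)))) [1..<Suc n])"
proof -
  interpret finite_category C
    by fact
  let ?X = "soc C (one_cset C)"
  have X: "is_cset C ?X" "semisimple C ?X"
    using semisimple_soc[OF is_cset_one] by (auto simp: semisimple_def)
  have S: "S i \<in> simple_csubsets C ?X" if "i \<in> {1..n}" for i
    using assms(3) that by (auto simp: bij_betw_def)
  then have cS: "is_cset C (S i)" if "i \<in> {1..n}" for i
    using that by (auto simp: simple_csubsets_def simple_cset_def)
  interpret recurrent_partition C "{1..n}" "\<lambda>i. supp C (S i)"
  proof
    fix i f assume "i \<in> {1..n}" "f \<in> Arr C" "Dom C f \<in> supp C (S i)"
    then show "Cod C f \<in> supp C (S i)"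
      using act_in[OF cS] by (auto simp: supp_def Cod_in)
  next
    fix i j x assume ij: "i \<in> {1..n}" "j \<in> {1..n}" and x: "x \<in> supp C (S i)" "x \<in> supp C (S j)"
    \<comment> \<open>All points are \<open>()\<close>, so supports that meet at \<open>x\<close>
      share a point there, and simple subsets with a common point coincide.\<close>
    then have "x \<in> Obj C" "() \<in> pts (S i) x" "() \<in> pts (S j) x"
      by (auto simp: supp_def)
    then have "S i = S j"
      using simple_csubset_eq_orbit[OF X(1) S[OF ij(1)], of x] simple_csubset_eq_orbit[OF X(1) S[OF ij(2)], of x]
      by simp
    then show "i = j"
      using inj_onD[OF bij_betw_imp_inj_on[OF assms(3)]] ij by blast
  next
    fix x assume x: "x \<in> Obj C" "recurrent C (one_cset C) x ()"
    then have "() \<in> pts ?X x"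
      by (simp add: pts_soc[OF is_cset_one]) (simp add: one_cset_def)
    \<comment> \<open>The \<open>S i\<close> enumerate the simple subsets of the socle
      \<open>?X\<close>, so the point is needed in the socle of \<open>?X\<close>. Taking the socle
      twice changes nothing, as every point of \<open>?X\<close> is recurrent in
      \<open>?X\<close>.\<close>
    then have "() \<in> pts (soc C ?X) x"
      using X x by (simp add: pts_soc semisimple_def)
    then obtain T where T: "T \<in> simple_csubsets C ?X" "() \<in> pts T x"
      using x(1) by (auto simp: soc_def[of C ?X])
    then obtain i where "i \<in> {1..n}" "T = S i"
      using assms(3) unfolding bij_betw_def by blast
    then show "\<exists>i \<in> {1..n}. x \<in> supp C (S i)"
      using T x(1) by (auto simp: supp_def)
  qed
  show ?thesis
    by (rule simple_burnside_ring_iso_RDirProd_list) auto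
qed

end
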